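(* Let $\alpha\in\mathbb{N}_0$ and $\beta>-1$. For any sufficiently smooth function $y$ on $(-1,1)$, the differential expression $L_{2\alpha+4,x}^{\alpha,\beta}y(x)=\sum_{i=1}^{2\alpha+4}d_i^{\alpha,\beta}(x)D_x^iy(x)$, whose coefficient functions $d_i^{\alpha,\beta}$ are given in the context, satisfies $$L_{2\alpha+4,x}^{\alpha,\beta}y(x)=\frac{x-1}{(x+1)^{\beta}}\,D_x^{\alpha+2}\Big\{(x+1)^{\alpha+\beta+2}D_x^{\alpha+2}\big[(x-1)^{\alpha+1}y(x)\big]\Big\},\qquad -1<x<1.$$ Consequently, for every $N>0$, the Jacobi-type polynomials $y_n(x)=P_n^{\alpha,\beta,0,N}(x)$, $n\in\mathbb{N}_0$, arise as eigensolutions of the equation $$N(x-1)^{\alpha+1}D_x^{\alpha+2}\Big\{(x+1)^{\alpha+\beta+2}D_x^{\alpha+2}\big[(x-1)^{\alpha+1}y_n(x)\big]\Big\}+C_{\alpha,\beta}D_x\big[(x-1)^{\alpha+1}(x+1)^{\beta+1}D_xy_n(x)\big]=\Lambda_{2\alpha+4,n}^{\alpha,\beta,N}(x-1)^{\alpha}(x+1)^{\beta}y_n(x),\qquad -1<x<1,$$ where $C_{\alpha,\beta}=(\alpha+2)!\,(\beta+1)_{\alpha+1}$ and the combined eigenvalue parameter is $$\Lambda_{2\alpha+4,n}^{\alpha,\beta,N}=\big[N(n+1)_{\alpha+1}(n+\beta)_{\alpha+1}+(2)_{\alpha+1}(\beta+1)_{\alpha+1}\big]\,n(n+\alpha+\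beta+1).$$
   Context: $\mathbb{N}=\{1,2,\dots\}$, $\mathbb{N}_0=\{0,1,2,\dots\}$; $(a)_k=a(a+1)\cdots(a+k-1)$, $(a)_0=1$, is the Pochhammer symbol; $D_x^i=(D_x)^i$ denotes $i$-fold differentiation with respect to $x$; ${}_2F_1$, ${}_3F_2$ are the usual (here terminating) generalized hypergeometric series. The coefficient functions are, for $1\le i\le 2\alpha+4$, $$d_i^{\alpha,\beta}(x)=-(\alpha+2)!\,(\beta+1)_{\alpha+2}\sum_{k=\max(0,\,i-\alpha-3)}^{i-1}\frac{(-2)^{i}(\alpha+3)_{i-1-k}(-\alpha-2)_{i-1-k}}{(\beta+1)_{i-1-k}\,(i-k)!\,(i-1-k)!\,k!}\;{}_3F_2\left(\begin{matrix}-k,\;\alpha+\beta+3,\;\alpha+i+2-k\\ \beta+i-k,\;i+1-k\end{matrix};1\right)\left(\frac{x-1}{2}\right)^{k+1}.$$ The classical Jacobi polynomials are $P_n^{\alpha,\beta}(x)=\frac{(\alpha+1)_n}{n!}\,{}_2F_1\big(-n,n+\alpha+\beta+1;\alpha+1;\frac{1-x}{2}\big)$, $n\in\mathbb{N}_0$. The Jacobi-type polynomials are $P_n^{\alpha,\beta,0,N}(x)=P_n^{\alpha,\beta}(x)+N R_n^{\alpha,\beta}(x)$, $n\in\mathbb{N}_0$, where $R_0^{\alpha,\beta}(x)=0$ and, for $n\in\mathbb{N}$, $R_n^{\alpha,\beta}(x)=A_n^{\alpha,\beta}(x-1)P_{n-1}^{\alpha+2,\beta}(x)$ with $A_n^{\alpha,\beta}=\dfrac{(\alpha+2)_{n-1}(\alpha+\beta+2)_n}{2\,n!\,(\beta+1)_{n-1}}$.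 *)

theory Defs
  imports "HOL-Analysis.Analysis"
begin

text \<open>
  The series \<open>pFq(as; bs; z)\<close>. It is only used with an upper parameter \<open>- real n\<close> and
  positive lower parameters, so that the coefficients vanish beyond \<open>n\<close> and the sum is finite.
\<close>

definition hypergeom :: "real list \<Rightarrow> real list \<Rightarrow> real \<Rightarrow> real" where
  "hypergeom as bs z = eval_fps (fps_hypergeo as bs 1) z"

definition Jacobi_P :: "real \<Rightarrow> real \<Rightarrow> nat \<Rightarrow> real \<Rightarrow> real" where
  "Jacobi_P a b n x =
     pochhammer (a + 1) n / fact n *
     hypergeom [- real n, real n + a + b + 1] [a + 1] ((1 - x) / 2)"

definition Jacobi_A :: "real \<Rightarrow> real \<Rightarrow> nat \<Rightarrow> real" where
  "Jacobi_A a b n =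
     pochhammer (a + 2) (n - 1) * pochhammer (a + b + 2) n /
     (2 * fact n * pochhammer (b + 1) (n - 1))"

definition Jacobi_R :: "real \<Rightarrow> real \<Rightarrow> nat \<Rightarrow> real \<Rightarrow> real" where
  "Jacobi_R a b n x =
     (if n = 0 then 0 else Jacobi_A a b n * (x - 1) * Jacobi_P (a + 2) b (n - 1) x)"

text \<open>The Jacobi-type polynomial with parameters \<open>(a, b, 0, N)\<close>.\<close>

definition Jacobi_type :: "real \<Rightarrow> real \<Rightarrow> real \<Rightarrow> nat \<Rightarrow> real \<Rightarrow> real" where
  "Jacobi_type a b N n x = Jacobi_P a b n x + N * Jacobi_R a b n x"

text \<open>
  The truncated subtraction on \<^typ>\<open>nat\<close> in the lower summation bound is the maximum with 0.
  The coefficients are meant for \<open>1 \<le> i \<le> 2 * \<alpha> + 4\<close>.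
\<close>

definition d_coeff :: "nat \<Rightarrow> real \<Rightarrow> nat \<Rightarrow> real \<Rightarrow> real" where
  "d_coeff \<alpha> \<beta> i x =
     - (fact (\<alpha> + 2) * pochhammer (\<beta> + 1) (\<alpha> + 2) *
       (\<Sum>k = i - (\<alpha> + 3)..i - 1.
          (- 2) ^ i * pochhammer (real \<alpha> + 3) (i - 1 - k) * pochhammer (- real \<alpha> - 2) (i - 1 - k) /
          (pochhammer (\<beta> + 1) (i - 1 - k) * fact (i - k) * fact (i - 1 - k) * fact k) *
          hypergeom [- real k, real \<alpha> + \<beta> + 3, real \<alpha> + real i + 2 - real k]
                    [\<beta> + real i - real k, real i + 1 - real k] 1 *
          ((x - 1) / 2) ^ (k + 1)))"

definition L_expr :: "nat \<Rightarrow> real \<Rightarrow> (real \<Rightarrow> real) \<Rightarrow> real \<Rightarrow> real" where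
  "L_expr \<alpha> \<beta> y x = (\<Sum>i = 1..2 * \<alpha> + 4. d_coeff \<alpha> \<beta> i x * (deriv ^^ i) y x)"

definition C_const :: "nat \<Rightarrow> real \<Rightarrow> real" where
  "C_const \<alpha> \<beta> = fact (\<alpha> + 2) * pochhammer (\<beta> + 1) (\<alpha> + 1)"

definition Lambda_eig :: "nat \<Rightarrow> real \<Rightarrow> real \<Rightarrow> nat \<Rightarrow> real" where
  "Lambda_eig \<alpha> \<beta> N n =
     (N * pochhammer (real n + 1) (\<alpha> + 1) * pochhammer (real n + \<beta>) (\<alpha> + 1)
      + pochhammer 2 (\<alpha> + 1) * pochhammer (\<beta> + 1) (\<alpha> + 1))
     * (real n * (real n + real \<alpha> + \<beta> + 1))"

text \<open>
  Existence of the first \<open>m\<close> derivatives at every point of \<open>S\<close>, for open \<open>S\<close>;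
  continuity of the last one is not demanded.
\<close>

definition times_differentiable_on :: "nat \<Rightarrow> (real \<Rightarrow> real) \<Rightarrow> real set \<Rightarrow> bool" where
  "times_differentiable_on m y S \<longleftrightarrow>
     (\<forall>j<m. \<forall>x\<in>S. (deriv ^^ j) y field_differentiable at x)"

end

theory Submission
  imports Defs
begin

text \<open>
  Put \<open>m = \<alpha> + 2\<close> and let \<open>L y = (x - 1) (x + 1)\<^bsup>-\<beta>\<^esup> D\<^sup>m {(x + 1)\<^bsup>\<beta>+m\<^esup> D\<^sup>m [(x - 1)\<^bsup>m-1\<^esup> y]}\<close> be the
  factorized form of the differential expression.

  The first claim says that \<open>L\<close> has the coefficient functions \<open>d\<^sub>i\<close>. By the Leibniz rule, \<open>L y\<close> at a
  point \<open>x\<close> depends linearly on the derivatives of \<open>y\<close> at \<open>x\<close> up to order \<open>2m\<close>, so \<open>y\<close> may be replaced by its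
  Taylor polynomial there, and \<open>d\<^sub>i x\<close> has to be the value of \<open>L\<close> on \<open>(t - x)\<^sup>i / i!\<close>. Powers of \<open>t - 1\<close>
  are easy to handle: \<open>L\<close> maps \<open>(t - 1)\<^sup>p\<close> to a sum over \<open>s \<le> m\<close> of explicit multiples of \<open>(x - 1)\<^bsup>p-s\<^esup>\<close>
  (\<open>Jacobi_weighted_op_monomial\<close>). Expanding \<open>(t - x)\<^sup>i\<close> in these powers gives an alternating binomial sum over \<open>p\<close>;
  the substitution \<open>s = i - 1 - k\<close>, \<open>p = s + 1 + j\<close> turns it, term by term, into the terminating
  \<open>3F2\<close> series in the definition of \<open>d\<^sub>i\<close> (\<open>d_coeff_eq\<close>, \<open>L_expr_eq\<close>).

  For the eigenvalue equation, let \<open>J\<close> be the classical Jacobi operator with eigenvalues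
  \<open>b = n (n + \<alpha> + \<beta> + 1)\<close>, let \<open>P\<close> be the Jacobi polynomial of degree \<open>n \<ge> 1\<close>, and let \<open>Q\<close> be the one of
  degree \<open>n - 1\<close> with parameters \<open>(\<alpha> + 2, \<beta>)\<close>, so that \<open>R = A (x - 1) Q\<close>. After division by the weight
  \<open>(x - 1)\<^sup>\<alpha> (x + 1)\<^sup>\<beta>\<close>, the equation reads \<open>(N L + C J) (P + N R) = (N a + C b) (P + N R)\<close> with
  \<open>a = (n)\<^sub>m (n + \<beta>)\<^sub>m\<close>. It follows by comparing the powers of \<open>N\<close> in

  \<^item> \<open>J P = b P\<close> and \<open>J ((x - 1) Q) = b (x - 1) Q + 2 (\<alpha> + 1) Q\<close>, which are direct computations
    (\<open>Jacobi_operator_eigen\<close>, \<open>Jacobi_operator_shifted\<close>);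
  \<^item> \<open>L ((x - 1) Q) = a (x - 1) Q\<close>, because the inner \<open>D\<^sup>m\<close> lowers the first parameter of \<open>Q\<close> to 0 while it raises
    the second, and the outer \<open>D\<^sup>m\<close> undoes this (\<open>Jacobi_weighted_op_shifted\<close>);
  \<^item> \<open>L P = a P - K Q\<close> with an explicit constant \<open>K\<close>, by the same ladder relations and a contiguous
    relation between \<open>P\<close> and \<open>Q\<close> (\<open>Jacobi_weighted_op_Jacobi_P\<close>, \<open>Jacobi_P_contiguous\<close>);
  \<^item> \<open>2 (\<alpha> + 1) A C = K\<close>, which cancels the multiples of \<open>Q\<close> (\<open>Jacobi_A_normalization\<close>).
\<close>

section \<open>Iterated derivatives on open sets\<close>

lemma times_differentiable_on_DERIV:
  assumes "times_differentiable_on k f S" "j < k" "x \<in> S"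
  shows "((deriv ^^ j) f has_real_derivative (deriv ^^ Suc j) f x) (at x)"
  using assms by (auto simp: times_differentiable_on_def intro: field_differentiable_derivI)

lemma times_differentiable_on_higher_deriv:
  assumes "times_differentiable_on k f S" "i + j \<le> k"
  shows "times_differentiable_on i ((deriv ^^ j) f) S"
  using assms unfolding times_differentiable_on_def
  by (auto simp flip: funpow_add[THEN fun_cong, unfolded o_apply])

text \<open>
  A formula for an iterated derivative that holds only on \<open>S\<close> can be differentiated again because \<open>S\<close> is
  open. So it suffices to guess all derivatives \<open>g j\<close> and to check one differentiation step; values and
  differentiability of sums, products and powers below are instances.
\<close>

lemma
  fixes g :: "nat \<Rightarrow> real \<Rightarrow> real"
  assumes S: "open S"
    and g: "\<And>j x. j < k \<Longrightarrow> x \<in> S \<Longrightarrow> (g j has_real_derivative g (Suc j) x) (at x)"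
    and f: "\<And>x. x \<in> S \<Longrightarrow> f x = g 0 x"
  shows higher_deriv_eq_chain: "\<And>j x. j \<le> k \<Longrightarrow> x \<in> S \<Longrightarrow> (deriv ^^ j) f x = g j x"
    and times_differentiable_on_chain: "times_differentiable_on k f S"
proof -
  have *: "((deriv ^^ j) f has_real_derivative g (Suc j) x) (at x)"
    if "j < k" "x \<in> S" "\<And>y. y \<in> S \<Longrightarrow> (deriv ^^ j) f y = g j y" for j x
    by (rule has_field_derivative_transform_within_open[OF g S]) (use that in auto)
  have eq: "(deriv ^^ j) f x = g j x" if "j \<le> k" "x \<in> S" for j x
    using that
  proof (induction j arbitrary: x)
    case (Suc j)
    have "((deriv ^^ j) f has_real_derivative g (Suc j) x) (at x)"
      by (rule *) (use Suc in auto)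
    then show ?case by (simp add: DERIV_imp_deriv)
  qed (simp add: f)
  then show "\<And>j x. j \<le> k \<Longrightarrow> x \<in> S \<Longrightarrow> (deriv ^^ j) f x = g j x" .
  show "times_differentiable_on k f S"
    unfolding times_differentiable_on_def field_differentiable_def
    using * eq by (meson less_imp_le_nat)
qed

lemma higher_deriv_cong_open:
  assumes S: "open S" and f: "times_differentiable_on k f S"
    and fg: "\<And>x. x \<in> S \<Longrightarrow> f x = g x"
    and j: "j \<le> k" and x: "x \<in> S"
  shows "(deriv ^^ j) g x = (deriv ^^ j) f x"
proof (rule higher_deriv_eq_chain[where g = "\<lambda>j. (deriv ^^ j) f",
      OF S times_differentiable_on_DERIV[OF f] _ j x])
  show "g t = (deriv ^^ 0) f t" if "t \<in> S" for t using fg that by simp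
qed

lemma
  fixes f :: "'i \<Rightarrow> real \<Rightarrow> real"
  assumes S: "open S" and f: "\<And>i. i \<in> I \<Longrightarrow> times_differentiable_on k (f i) S"
  shows higher_deriv_linear_combination:
      "j \<le> k \<Longrightarrow> x \<in> S \<Longrightarrow> 
         (deriv ^^ j) (\<lambda>x. \<Sum>i\<in>I. c i * f i x) x = (\<Sum>i\<in>I. c i * (deriv ^^ j) (f i) x)"
    and times_differentiable_on_linear_combination:
      "times_differentiable_on k (\<lambda>x. \<Sum>i\<in>I. c i * f i x) S"
proof -
  let ?g = "\<lambda>j x. \<Sum>i\<in>I. c i * (deriv ^^ j) (f i) x"
  have D: "(?g j has_real_derivative ?g (Suc j) x) (at x)" if "j < k" "x \<in> S" for j x
    by (intro DERIV_sum DERIV_cmult times_differentiable_on_DERIV[OF f] that)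
  have e: "(\<Sum>i\<in>I. c i * f i x) = ?g 0 x" if "x \<in> S" for x by simp
  show "j \<le> k \<Longrightarrow> x \<in> S \<Longrightarrow> (deriv ^^ j) (\<lambda>x. \<Sum>i\<in>I. c i * f i x) x = ?g j x"
    using higher_deriv_eq_chain[OF S D e] .
  show "times_differentiable_on k (\<lambda>x. \<Sum>i\<in>I. c i * f i x) S"
    using times_differentiable_on_chain[OF S D e] .
qed

text \<open>
  Pascal's rule, in the form needed to differentiate the Leibniz expansion once more.
\<close>

lemma Leibniz_sum_step:
  fixes a b :: "nat \<Rightarrow> real"
  shows "(\<Sum>i\<le>n. real (n choose i) * (a (Suc i) * b (n - i) + a i * b (Suc (n - i)))) =
         (\<Sum>i\<le>Suc n. real (Suc n choose i) * (a i * b (Suc n - i)))"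
proof -
  have "(\<Sum>i\<le>Suc n. real (Suc n choose i) * (a i * b (Suc n - i))) =
      (\<Sum>i\<le>n. real (n choose i) * (a (Suc i) * b (n - i))) +
      (a 0 * b (Suc n) + (\<Sum>i\<le>n. real (n choose Suc i) * (a (Suc i) * b (n - i))))"
    by (subst sum.atMost_Suc_shift) (simp add: algebra_simps sum.distrib)
  also have "a 0 * b (Suc n) + (\<Sum>i\<le>n. real (n choose Suc i) * (a (Suc i) * b (n - i))) =
      (\<Sum>i\<le>Suc n. real (n choose i) * (a i * b (Suc n - i)))"
    by (subst sum.atMost_Suc_shift) simp
  also have "\<dots> = (\<Sum>i\<le>n. real (n choose i) * (a i * b (Suc (n - i))))"
    by (simp add: Suc_diff_le)
  finally show ?thesis by (simp add: algebra_simps sum.distrib)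
qed

lemma
  assumes S: "open S" and f: "times_differentiable_on k f S" and g: "times_differentiable_on k g S"
  shows higher_deriv_mult_real:
      "j \<le> k \<Longrightarrow> x \<in> S \<Longrightarrow> (deriv ^^ j) (\<lambda>x. f x * g x) x =
         (\<Sum>i\<le>j. real (j choose i) * ((deriv ^^ i) f x * (deriv ^^ (j - i)) g x))"
    and times_differentiable_on_mult: "times_differentiable_on k (\<lambda>x. f x * g x) S"
proof -
  let ?g = "\<lambda>j x. \<Sum>i\<le>j. real (j choose i) * ((deriv ^^ i) f x * (deriv ^^ (j - i)) g x)"
  have D: "(?g j has_real_derivative ?g (Suc j) x) (at x)" if "j < k" "x \<in> S" for j x
  proof -
    have "(?g j has_real_derivative (\<Sum>i\<le>j. real (j choose i) * 
        ((deriv ^^ Suc i) f x * (deriv ^^ (j - i)) g x + 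
         (deriv ^^ i) f x * (deriv ^^ Suc (j - i)) g x))) (at x)"
    proof (intro DERIV_sum DERIV_cmult)
      fix i assume "i \<in> {..j}"
      show "((\<lambda>x. (deriv ^^ i) f x * (deriv ^^ (j - i)) g x) has_real_derivative
         (deriv ^^ Suc i) f x * (deriv ^^ (j - i)) g x + 
         (deriv ^^ i) f x * (deriv ^^ Suc (j - i)) g x) (at x)"
        by (rule DERIV_mult'[THEN DERIV_cong],
            rule times_differentiable_on_DERIV[OF f], use that \<open>i \<in> _\<close> in simp, use that in simp,
            rule times_differentiable_on_DERIV[OF g], use that \<open>i \<in> _\<close> in simp, use that in simp,
            simp)
    qed
    then show ?thesis by (subst (asm) Leibniz_sum_step)
  qed
  have e: "f x * g x = ?g 0 x" if "x \<in> S" for x by simp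
  show "j \<le> k \<Longrightarrow> x \<in> S \<Longrightarrow> (deriv ^^ j) (\<lambda>x. f x * g x) x = ?g j x"
    using higher_deriv_eq_chain[OF S D e] .
  show "times_differentiable_on k (\<lambda>x. f x * g x) S"
    using times_differentiable_on_chain[OF S D e] .
qed

text \<open>
  The Leibniz rule collapses to two terms because a linear factor has no second derivative. When the
  differential expression is applied to a classical Jacobi polynomial, both weights exceed by one
  linear factor what the ladder relations absorb, and this rule disposes of that factor.
\<close>

lemma higher_deriv_linear_factor:
  fixes c :: real
  assumes S: "open S" and f: "times_differentiable_on j f S" and x: "x \<in> S"
  shows "(deriv ^^ j) (\<lambda>t. (t - c) * f t) x =
           (x - c) * (deriv ^^ j) f x + real j * (deriv ^^ (j - 1)) f x"
proof -
  let ?g = "\<lambda>i t. (t - c) * (deriv ^^ i) f t + real i * (deriv ^^ (i - 1)) f t"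
  have D: "(?g i has_real_derivative ?g (Suc i) y) (at y)" if "i < j" "y \<in> S" for i y
  proof (cases i)
    case 0
    then show ?thesis using times_differentiable_on_DERIV[OF f that]
      by (auto intro!: derivative_eq_intros)
  next
    case (Suc l)
    have "((deriv ^^ i) f has_real_derivative (deriv ^^ Suc i) f y) (at y)"
      "((deriv ^^ (i - 1)) f has_real_derivative (deriv ^^ i) f y) (at y)"
      using times_differentiable_on_DERIV[OF f _ \<open>y \<in> S\<close>, of i]
        times_differentiable_on_DERIV[OF f _ \<open>y \<in> S\<close>, of l] that Suc by auto
    then show ?thesis
      by (auto intro!: derivative_eq_intros simp: algebra_simps simp del: funpow.simps)
  qed
  show ?thesis
    by (rule higher_deriv_eq_chain[where g = ?g and k = j, OF S D _ order_refl x]) auto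
qed

lemma
  fixes c :: real
  assumes S: "open S"
  shows higher_deriv_power_shift:
      "x \<in> S \<Longrightarrow> (deriv ^^ k) (\<lambda>t. (t - c) ^ p) x = real (p choose k) * fact k * (x - c) ^ (p - k)"
    and times_differentiable_on_power_shift: "times_differentiable_on k (\<lambda>t. (t - c) ^ p) S"
proof -
  let ?g = "\<lambda>j t. real (p choose j) * fact j * (t - c) ^ (p - j)"
  have D: "(?g j has_real_derivative ?g (Suc j) x) (at x)" for j x
  proof -
    have "(p - j) * (p choose j) = Suc j * (p choose Suc j)"
      by (metis binomial_absorb_comp binomial_absorption mult.commute)
    then have *: "real (p - j) * real (p choose j) = (1 + real j) * real (p choose Suc j)"
      by (metis of_nat_mult of_nat_Suc)
    have "(?g j has_real_derivative
     fact j * (real (p - j) * real (p choose j)) * (x - c) ^ (p - Suc j)) (at x)"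
      by (auto intro!: derivative_eq_intros)
    then show ?thesis unfolding * by (simp add: algebra_simps)
  qed
  show "x \<in> S \<Longrightarrow> (deriv ^^ k) (\<lambda>t. (t - c) ^ p) x = ?g k x"
    by (rule higher_deriv_eq_chain[where g = ?g and k = k, OF S D]) auto
  show "times_differentiable_on k (\<lambda>t. (t - c) ^ p) S"
    by (rule times_differentiable_on_chain[where g = ?g, OF S D]) auto
qed

lemma times_differentiable_on_powr_shift:
  fixes a c :: real
  assumes "open S" "S \<subseteq> {- c<..}"
  shows "times_differentiable_on k (\<lambda>t. (t + c) powr a) S"
proof (rule times_differentiable_on_chain[OF assms(1)])
  show "((\<lambda>t. (\<Prod>i<j. a - real i) * (t + c) powr (a - real j)) has_real_derivative
     (\<Prod>i<Suc j. a - real i) * (x + c) powr (a - real (Suc j))) (at x)" if "x \<in> S" for j x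
  proof -
    have "x + c > 0" using assms that by force
    then show ?thesis 
      by (auto intro!: derivative_eq_intros simp: diff_diff_eq algebra_simps)
  qed
qed auto

section \<open>The differential expression on powers of x - 1\<close>

lemma hypergeom_terminating:
  assumes "\<And>j. j > k \<Longrightarrow> fps_nth (fps_hypergeo as bs 1) j = 0"
  shows "hypergeom as bs z = (\<Sum>j\<le>k. fps_nth (fps_hypergeo as bs 1) j * z ^ j)"
  unfolding hypergeom_def eval_fps_def
  by (rule suminf_finite) (use assms in \<open>auto simp: not_le\<close>)

lemma pochhammer_minus_nat_eq_0: "k < j \<Longrightarrow> pochhammer (- real k) j = 0"
  by (auto simp: pochhammer_eq_0_iff)

text \<open>
  The core shared by the factorized differential expression, where its prefactor is
  \<open>(x - 1) (x + 1)\<^bsup>-\<beta>\<^esup>\<close>, and by the eigenvalue equation, where it is \<open>N (x - 1)\<^sup>\<alpha>\<^sup>+\<^sup>1\<close>.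
\<close>

definition Jacobi_weighted_op :: "nat \<Rightarrow> real \<Rightarrow> (real \<Rightarrow> real) \<Rightarrow> real \<Rightarrow> real" where
  "Jacobi_weighted_op \<alpha> \<beta> y x =
     (deriv ^^ (\<alpha> + 2)) (\<lambda>t. (t + 1) powr (real \<alpha> + \<beta> + 2) *
        (deriv ^^ (\<alpha> + 2)) (\<lambda>s. (s - 1) ^ (\<alpha> + 1) * y s) t) x"

text \<open>
  By the Leibniz rule, the value at \<open>x\<close> is a combination of the derivatives of \<open>y\<close> at \<open>x\<close> up to order
  \<open>2 * m\<close>. This is what allows a function with only \<open>2 * m\<close> derivatives to be replaced by its Taylor
  polynomial at \<open>x\<close>.
\<close>

lemma weighted_higher_deriv_cong_jet:
  fixes v w y z :: "real \<Rightarrow> real"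
  assumes S: "open S" "x \<in> S"
    and v: "times_differentiable_on (2 * m) v S" and w: "times_differentiable_on m w S"
    and y: "times_differentiable_on (2 * m) y S" and z: "times_differentiable_on (2 * m) z S"
    and jet: "\<And>j. j \<le> 2 * m \<Longrightarrow> (deriv ^^ j) y x = (deriv ^^ j) z x"
  shows "(deriv ^^ m) (\<lambda>t. w t * (deriv ^^ m) (\<lambda>s. v s * y s) t) x =
         (deriv ^^ m) (\<lambda>t. w t * (deriv ^^ m) (\<lambda>s. v s * z s) t) x"
proof -
  have inner: "(deriv ^^ j) (\<lambda>s. v s * y s) x = (deriv ^^ j) (\<lambda>s. v s * z s) x" if "j \<le> 2 * m" for j
    using higher_deriv_mult_real[OF S(1) v y that S(2)] higher_deriv_mult_real[OF S(1) v z that S(2)]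
      jet that by (auto intro!: sum.cong)
  have inner': "(deriv ^^ j) ((deriv ^^ m) (\<lambda>s. v s * y s)) x =
      (deriv ^^ j) ((deriv ^^ m) (\<lambda>s. v s * z s)) x" if "j \<le> m" for j
    using inner[of "j + m"] that by (simp add: funpow_add)
  have "times_differentiable_on m ((deriv ^^ m) (\<lambda>s. v s * y s)) S"
    "times_differentiable_on m ((deriv ^^ m) (\<lambda>s. v s * z s)) S"
    by (intro times_differentiable_on_higher_deriv[of "2 * m"] times_differentiable_on_mult S v y z; simp)+
  from this[THEN higher_deriv_mult_real[OF S(1) w _ order_refl S(2)]] show ?thesis
    by (auto intro!: sum.cong simp: inner')
qed

lemma weighted_higher_deriv_linear_combination:
  fixes v w :: "real \<Rightarrow> real" and f :: "'i \<Rightarrow> real \<Rightarrow> real"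
  assumes S: "open S" "x \<in> S"
    and v: "times_differentiable_on (2 * m) v S" and w: "times_differentiable_on m w S"
    and f: "\<And>i. i \<in> I \<Longrightarrow> times_differentiable_on (2 * m) (f i) S"
  shows "(deriv ^^ m) (\<lambda>t. w t * (deriv ^^ m) (\<lambda>s. v s * (\<Sum>i\<in>I. c i * f i s)) t) x =
         (\<Sum>i\<in>I. c i * (deriv ^^ m) (\<lambda>t. w t * (deriv ^^ m) (\<lambda>s. v s * f i s) t) x)"
proof -
  have vf: "times_differentiable_on (2 * m) (\<lambda>s. v s * f i s) S" if "i \<in> I" for i
    by (intro times_differentiable_on_mult S v f that)
  have wvf: "times_differentiable_on m (\<lambda>t. w t * (deriv ^^ m) (\<lambda>s. v s * f i s) t) S" if "i \<in> I" for i
    by (intro times_differentiable_on_mult S w times_differentiable_on_higher_deriv[of "2 * m"] vf that)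
       auto
  have "(deriv ^^ m) (\<lambda>s. v s * (\<Sum>i\<in>I. c i * f i s)) t =
      (\<Sum>i\<in>I. c i * (deriv ^^ m) (\<lambda>s. v s * f i s) t)" if "t \<in> S" for t
    using higher_deriv_linear_combination[OF S(1) vf _ that, of I _ m c] 
    by (simp add: sum_distrib_left mult_ac)
  then have "(\<Sum>i\<in>I. c i * (w t * (deriv ^^ m) (\<lambda>s. v s * f i s) t)) =
      w t * (deriv ^^ m) (\<lambda>s. v s * (\<Sum>i\<in>I. c i * f i s)) t" if "t \<in> S" for t
    using that by (simp add: sum_distrib_left mult_ac)
  from higher_deriv_cong_open[OF S(1) times_differentiable_on_linear_combination this order_refl S(2)]
  show ?thesis
    using higher_deriv_linear_combination[OF S(1) wvf order_refl S(2)] wvf S by simp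
qed

text \<open>
  In the induction step the formula for \<open>m\<close>, applied with \<open>b + 1\<close>, is differentiated once. Writing
  \<open>x + 1 = (x - 1) + 2\<close>, each coefficient for \<open>Suc m\<close> comes from two neighbouring ones for \<open>m\<close>, which
  combine by Pascal's rule and \<open>(r + 1) (m choose (r + 1)) = (m - r) (m choose r)\<close>.
\<close>

lemma higher_deriv_powr_mult_power:
  assumes "x > -1"
  shows "(deriv ^^ m) (\<lambda>t. (t + 1) powr (b + real m) * (t - 1) ^ q) x =
    (x + 1) powr b * (\<Sum>s\<le>m. real (m choose s) * (fact s * real (q choose s)) *
       pochhammer (b + real q + 1) (m - s) * 2 ^ s * (x - 1) ^ (q - s))"
  using assms
proof (induction m arbitrary: b x)
  case (Suc m)
  \<comment> \<open>\<open>P\<close> collects the Pochhammer factors of the induction hypothesis for \<open>b + 1\<close>, and \<open>X s\<close> is the part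
    of the summand that is common to all \<open>m\<close>.\<close>
  define P where "P = pochhammer (b + real q + 2)"
  define X where "X = (\<lambda>s. (fact s * real (q choose s)) * 2 ^ s * (x - 1) ^ (q - s))"
  define c where "c = (\<lambda>s. real (m choose s) * (fact s * real (q choose s)) * P (m - s) * 2 ^ s)"
  have falling: "real (q - s) * (fact s * real (q choose s)) = fact (Suc s) * real (q choose Suc s)" for s
  proof -
    have "(q - s) * (q choose s) = Suc s * (q choose Suc s)"
      by (metis binomial_absorb_comp binomial_absorption mult.commute)
    then have "real (q - s) * real (q choose s) = real (Suc s) * real (q choose Suc s)"
      by (metis of_nat_mult)
    then show ?thesis by (simp add: algebra_simps)
  qed
  have "((\<lambda>t. (t + 1) powr (b + 1) * (\<Sum>s\<le>m. c s * (t - 1) ^ (q - s))) has_real_derivative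
      (b + 1) * (x + 1) powr b * (\<Sum>s\<le>m. c s * (x - 1) ^ (q - s)) +
      (x + 1) powr (b + 1) * (\<Sum>s\<le>m. c s * (real (q - s) * (x - 1) ^ (q - s - 1)))) (at x)"
    using Suc.prems by (auto intro!: derivative_eq_intros sum.cong)
  also have "(b + 1) * (x + 1) powr b * (\<Sum>s\<le>m. c s * (x - 1) ^ (q - s)) +
      (x + 1) powr (b + 1) * (\<Sum>s\<le>m. c s * (real (q - s) * (x - 1) ^ (q - s - 1))) = 
      (x + 1) powr b * (\<Sum>s\<le>m. (b + 1) * (c s * (x - 1) ^ (q - s)) + 
         c s * (real (q - s) * ((x + 1) * (x - 1) ^ (q - s - 1))))"
    using Suc.prems by (simp add: powr_add sum_distrib_left sum.distrib algebra_simps)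
  also have "(\<Sum>s\<le>m. (b + 1) * (c s * (x - 1) ^ (q - s)) + 
         c s * (real (q - s) * ((x + 1) * (x - 1) ^ (q - s - 1)))) =
      (\<Sum>s\<le>m. real (m choose s) * P (m - s) * (b + 1 + real q - real s) * X s) +
      (\<Sum>s\<le>m. real (m choose s) * P (m - s) * X (Suc s))"
    unfolding sum.distrib[symmetric]
  proof (rule sum.cong[OF refl])
    fix s
    \<comment> \<open>This is \<open>x + 1 = (x - 1) + 2\<close>; for \<open>q \<le> s\<close>, where the exponents are truncated, both sides are 0.\<close>
    have a: "real (q - s) * ((x + 1) * (x - 1) ^ (q - s - 1)) =
        real (q - s) * (x - 1) ^ (q - s) + 2 * real (q - s) * (x - 1) ^ (q - Suc s)"
    proof (cases "q - s")
      case (Suc n)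
      then have "q - Suc s = n" by simp
      with Suc show ?thesis by (simp add: algebra_simps)
    qed simp
    have b: "X (Suc s) = 2 * (real (q - s) * (fact s * real (q choose s))) * 2 ^ s * (x - 1) ^ (q - Suc s)"
      unfolding X_def falling by simp
    have c: "real (q choose s) * (real q - real s) = real (q choose s) * real (q - s)"
      by (cases "s \<le> q") auto
    have "real (m choose s) * P (m - s) * (b + 1 + real q - real s) * X s =
      real (m choose s) * P (m - s) * fact s * 2 ^ s * (x - 1) ^ (q - s) *
       ((b + 1) * real (q choose s) + real (q choose s) * (real q - real s))"
      by (simp add: X_def algebra_simps)
    also have "\<dots> = (b + 1) * (c s * (x - 1) ^ (q - s)) + c s * (real (q - s) * (x - 1) ^ (q - s))"
      unfolding c by (simp add: c_def algebra_simps)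
    finally show "(b + 1) * (c s * (x - 1) ^ (q - s)) + 
         c s * (real (q - s) * ((x + 1) * (x - 1) ^ (q - s - 1))) =
      real (m choose s) * P (m - s) * (b + 1 + real q - real s) * X s +
      real (m choose s) * P (m - s) * X (Suc s)"
      unfolding a b by (simp add: c_def algebra_simps)
  qed
  \<comment> \<open>Shift the second sum by one, so that both sums run over the powers \<open>X s\<close> with \<open>s \<le> Suc m\<close>.\<close>
  also have "(\<Sum>s\<le>m. real (m choose s) * P (m - s) * X (Suc s)) =
      (\<Sum>s\<le>Suc m. (case s of 0 \<Rightarrow> 0 | Suc r \<Rightarrow> real (m choose r)) * P (Suc m - s) * X s)"
    by (subst sum.atMost_Suc_shift) simp
  also have "(\<Sum>s\<le>m. real (m choose s) * P (m - s) * (b + 1 + real q - real s) * X s) =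
      (\<Sum>s\<le>Suc m. real (m choose s) * P (m - s) * (b + 1 + real q - real s) * X s)"
    by simp
  also have "(\<Sum>s\<le>Suc m. real (m choose s) * P (m - s) * (b + 1 + real q - real s) * X s) +
      (\<Sum>s\<le>Suc m. (case s of 0 \<Rightarrow> 0 | Suc r \<Rightarrow> real (m choose r)) * P (Suc m - s) * X s) =
      (\<Sum>s\<le>Suc m. real (Suc m choose s) * pochhammer (b + real q + 1) (Suc m - s) * X s)"
    unfolding sum.distrib[symmetric]
  proof (rule sum.cong[OF refl])
    fix s assume "s \<in> {..Suc m}"
    have P: "pochhammer (b + real q + 1) (Suc d) = (b + real q + 1) * P d" for d
      unfolding P_def pochhammer_rec by (simp add: algebra_simps)
    have "real (m choose s) * P (m - s) * (b + 1 + real q - real s) +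
       (case s of 0 \<Rightarrow> 0 | Suc r \<Rightarrow> real (m choose r)) * P (Suc m - s) =
       real (Suc m choose s) * pochhammer (b + real q + 1) (Suc m - s)"
    proof (cases s)
      case 0
      then show ?thesis by (simp add: P)
    next
      case (Suc r)
      show ?thesis
      proof (cases "r = m")
        case False
        then obtain d where d: "m = r + Suc d" using Suc \<open>s \<in> _\<close> 
          by (metis atMost_iff Suc_le_mono add_Suc_right less_iff_Suc_add le_neq_implies_less)
        have "Suc r * (m choose Suc r) = Suc d * (m choose r)"
          using binomial_absorb_comp[of m r] binomial_absorption[of r m] d by simp
        then have e: "real (m choose Suc r) * (real r + 1) = real (m choose r) * (real d + 1)"
          by (metis of_nat_mult of_nat_Suc mult.commute add.commute)
        have "real (m choose s) * P (m - s) * (b + 1 + real q - real s) +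
           (case s of 0 \<Rightarrow> 0 | Suc r \<Rightarrow> real (m choose r)) * P (Suc m - s) = 
           P d * (real (m choose Suc r) * (b + real q + 1) - real (m choose Suc r) * (real r + 1) +
           real (m choose r) * (b + real q + 2 + d))"
          unfolding Suc by (simp add: d P_def pochhammer_Suc) (simp add: algebra_simps)
        also have "\<dots> = P d * (b + real q + 1) * (real (m choose Suc r) + real (m choose r))"
          unfolding e by (simp add: algebra_simps)
        also have "\<dots> = real (Suc m choose s) * pochhammer (b + real q + 1) (Suc m - s)"
        proof -
          have "real (Suc m choose Suc r) = real (m choose Suc r) + real (m choose r)"
            "Suc m - Suc r = Suc d"
            using d by simp_all
          then show ?thesis unfolding Suc by (simp only: P mult_ac)
        qed
        finally show ?thesis .
      qed (simp add: Suc P_def)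
    qed
    then show "real (m choose s) * P (m - s) * (b + 1 + real q - real s) * X s + 
       (case s of 0 \<Rightarrow> 0 | Suc r \<Rightarrow> real (m choose r)) * P (Suc m - s) * X s =
       real (Suc m choose s) * pochhammer (b + real q + 1) (Suc m - s) * X s"
      by (metis distrib_right)
  qed
  finally have *: "((\<lambda>t. (t + 1) powr (b + 1) * (\<Sum>s\<le>m. c s * (t - 1) ^ (q - s))) has_real_derivative
     (x + 1) powr b * (\<Sum>s\<le>Suc m. real (Suc m choose s) * 
        pochhammer (b + real q + 1) (Suc m - s) * X s)) (at x)" .
  have eq: "(deriv ^^ m) (\<lambda>t. (t + 1) powr (b + real (Suc m)) * (t - 1) ^ q) t = 
       (t + 1) powr (b + 1) * (\<Sum>s\<le>m. c s * (t - 1) ^ (q - s))" if "t > -1" for t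
    using Suc.IH[OF that, of "b + 1"] by (simp add: c_def P_def algebra_simps)
  have "((deriv ^^ m) (\<lambda>t. (t + 1) powr (b + real (Suc m)) * (t - 1) ^ q) has_real_derivative
     (x + 1) powr b * (\<Sum>s\<le>Suc m. real (Suc m choose s) * 
        pochhammer (b + real q + 1) (Suc m - s) * X s)) (at x)"
    by (rule has_field_derivative_transform_within_open[OF *, of "{-1<..}"]) (use Suc.prems eq in auto)
  then show ?case by (simp add: DERIV_imp_deriv X_def mult_ac)
qed auto

lemma fact_add_eq_pochhammer: "fact (q + m) = fact q * pochhammer (real q + 1) m"
  by (induction m) (simp_all add: pochhammer_Suc algebra_simps)

lemma falling_factorial_eq: "fact s * real ((s + j) choose s) = fact (s + j) / fact j"
  by (simp add: binomial_fact)

text \<open>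
  The coefficient of \<open>2\<^sup>s (x - 1)\<^bsup>p-s\<^esup>\<close> when \<open>(x - 1) (x + 1)\<^bsup>-\<beta>\<^esup> D\<^sup>m (x + 1)\<^bsup>\<beta>+m\<^esup> D\<^sup>m (x - 1)\<^bsup>m-1\<^esup>\<close> is applied to
  \<open>(x - 1)\<^sup>p\<close>. For \<open>p = 0\<close> the truncated \<open>p - 1\<close> is harmless: if \<open>m > 0\<close>, the factor
  \<open>pochhammer 0 m\<close> makes the coefficient vanish, as it must since \<open>D\<^sup>m (x - 1)\<^bsup>m-1\<^esup> = 0\<close>.
\<close>

definition monomial_coeff :: "nat \<Rightarrow> real \<Rightarrow> nat \<Rightarrow> nat \<Rightarrow> real" where
  "monomial_coeff m \<beta> p s = pochhammer (real p) m * (real (m choose s) *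
     (fact s * real ((p - 1) choose s)) * pochhammer (\<beta> + real p) (m - s))"

lemma Jacobi_weighted_op_monomial:
  assumes x: "x \<in> {-1<..<1}"
  shows "(x - 1) / (x + 1) powr \<beta> * Jacobi_weighted_op \<alpha> \<beta> (\<lambda>t. (t - 1) ^ p) x =
    (\<Sum>s\<le>\<alpha> + 2. monomial_coeff (\<alpha> + 2) \<beta> p s * 2 ^ s * (x - 1) ^ (p - s))"
proof -
  let ?S = "{-1<..<1 :: real}" and ?m = "\<alpha> + 2"
  let ?w = "\<lambda>t. (t + 1) powr (real \<alpha> + \<beta> + 2)"
  have coeff: "real ((\<alpha> + 1 + p) choose ?m) * fact ?m = pochhammer (real p) ?m"
  proof (cases p)
    case (Suc q)
    have "real ((?m + q) choose ?m) * fact ?m = fact (?m + q) / fact q"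
      by (metis falling_factorial_eq mult.commute)
    also have "?m + q = \<alpha> + 1 + p" using Suc by simp
    also have "fact (\<alpha> + 1 + p) = (fact (q + ?m) :: real)" 
      using Suc by (simp del: fact_Suc add: add_ac)
    also have "\<dots> / fact q = pochhammer (real p) ?m"
      using Suc by (simp only: fact_add_eq_pochhammer) (simp add: add_ac)
    finally show ?thesis .
  qed (simp add: binomial_eq_0 pochhammer_0_left)
  have inner: "(deriv ^^ ?m) (\<lambda>s. (s - 1) ^ (\<alpha> + 1) * (s - 1) ^ p) t =
     pochhammer (real p) ?m * (t - 1) ^ (p - 1)" if "t \<in> ?S" for t :: real
    unfolding power_add[symmetric] 
    using higher_deriv_power_shift[OF open_greaterThanLessThan that, of ?m 1 "\<alpha> + 1 + p"]
    by (simp only: coeff) simp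
  have tdo: "times_differentiable_on ?m (\<lambda>t. ?w t * (t - 1) ^ (p - 1)) ?S"
    by (intro times_differentiable_on_mult times_differentiable_on_powr_shift
              times_differentiable_on_power_shift) auto
  then have tdo': "times_differentiable_on ?m (\<lambda>t. \<Sum>i\<in>{()}. pochhammer (real p) ?m * (?w t * (t - 1) ^ (p - 1))) ?S"
    by (intro times_differentiable_on_linear_combination) auto
  have "Jacobi_weighted_op \<alpha> \<beta> (\<lambda>t. (t - 1) ^ p) x = 
    (deriv ^^ ?m) (\<lambda>t. \<Sum>i\<in>{()}. pochhammer (real p) ?m * (?w t * (t - 1) ^ (p - 1))) x"
    unfolding Jacobi_weighted_op_def
    by (rule higher_deriv_cong_open[OF _ tdo' _ order_refl x]) (use inner in auto)
  also have "\<dots> = pochhammer (real p) ?m * (deriv ^^ ?m) (\<lambda>t. ?w t * (t - 1) ^ (p - 1)) x"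
    using higher_deriv_linear_combination[where I = "{()}" and c = "\<lambda>_. pochhammer (real p) ?m", OF _ tdo order_refl x]
    by simp
  also have "(deriv ^^ ?m) (\<lambda>t. ?w t * (t - 1) ^ (p - 1)) x =
     (x + 1) powr \<beta> * (\<Sum>s\<le>?m. real (?m choose s) * (fact s * real ((p - 1) choose s)) *
       pochhammer (\<beta> + real (p - 1) + 1) (?m - s) * 2 ^ s * (x - 1) ^ (p - 1 - s))"
    using higher_deriv_powr_mult_power[of x ?m \<beta> "p - 1"] x by (simp add: add_ac)
  finally have eq: "(x - 1) / (x + 1) powr \<beta> * Jacobi_weighted_op \<alpha> \<beta> (\<lambda>t. (t - 1) ^ p) x =
    (\<Sum>s\<le>?m. pochhammer (real p) ?m * (real (?m choose s) * (fact s * real ((p - 1) choose s)) *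
       pochhammer (\<beta> + real (p - 1) + 1) (?m - s)) * 2 ^ s * ((x - 1) * (x - 1) ^ (p - 1 - s)))"
    using x by (simp add: sum_distrib_left mult_ac del: add_2_eq_Suc')
  show ?thesis
    unfolding eq
  proof (rule sum.cong[OF refl])
    fix s
    show "pochhammer (real p) ?m * (real (?m choose s) * (fact s * real ((p - 1) choose s)) *
       pochhammer (\<beta> + real (p - 1) + 1) (?m - s)) * 2 ^ s * ((x - 1) * (x - 1) ^ (p - 1 - s)) =
       monomial_coeff ?m \<beta> p s * 2 ^ s * (x - 1) ^ (p - s)"
    proof (cases "s < p")
      case True
      then have "(x - 1) * (x - 1) ^ (p - 1 - s) = (x - 1) ^ (p - s)"
        by (metis Suc_diff_Suc diff_diff_left plus_1_eq_Suc power_Suc)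
      moreover have "\<beta> + real (p - 1) + 1 = \<beta> + real p" using True by simp
      ultimately show ?thesis by (simp only: monomial_coeff_def)
    next
      case False
      then show ?thesis
        by (cases p) (auto simp: monomial_coeff_def binomial_eq_0 pochhammer_0_left)
    qed
  qed
qed

lemma monomial_coeff_eq_0: "p \<le> s \<Longrightarrow> 0 < m \<Longrightarrow> monomial_coeff m \<beta> p s = 0"
  by (cases p) (auto simp: monomial_coeff_def pochhammer_0_left)

text \<open>
  The bridge to the \<open>3F2\<close> series: with \<open>p = s + 1 + j\<close>, each factor of \<open>monomial_coeff m \<beta> p s\<close> splits
  into a part independent of \<open>j\<close> and a Pochhammer symbol of length \<open>j\<close>. The equations \<open>p1\<close> to \<open>p6\<close> are
  these splittings.
\<close>

lemma monomial_coeff_hypergeometric_term: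
  assumes \<beta>: "\<beta> > -1" and s: "s \<le> m" and j: "j \<le> k"
  shows "(-1) ^ (k - j) / (fact (s + 1 + j) * fact (k - j)) * monomial_coeff m \<beta> (s + 1 + j) s =
    - (fact m * pochhammer (\<beta> + 1) m * ((-1) ^ (s + 1 + k) * pochhammer (real m + 1) s * pochhammer (- real m) s /
        (pochhammer (\<beta> + 1) s * fact (s + 1) * fact s * fact k)) *
      (pochhammer (- real k) j * pochhammer (real m + \<beta> + 1) j * pochhammer (real m + real s + 1) j /
        (pochhammer (\<beta> + real s + 1) j * pochhammer (real s + 2) j * fact j)))"
proof -
  have pos: "pochhammer (\<beta> + 1) s > 0" "pochhammer (\<beta> + real s + 1) j > 0" "pochhammer (real s + 2) j > 0"
    using \<beta> by (auto intro!: pochhammer_pos)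
  have p1: "pochhammer (real (s + 1 + j)) m = fact m * pochhammer (real m + 1) s * pochhammer (real m + real s + 1) j / fact (s + j)"
  proof -
    have "fact (s + j) * pochhammer (real (s + 1 + j)) m = fact (m + (s + j))"
      using fact_add_eq_pochhammer[of "s + j" m] by (simp add: add_ac)
    also have "\<dots> = fact m * pochhammer (real m + 1) s * pochhammer (real m + real s + 1) j"
      unfolding fact_add_eq_pochhammer[of m "s + j"] pochhammer_product' by (simp add: add_ac)
    finally show ?thesis by (simp add: field_simps)
  qed
  have p2: "pochhammer (\<beta> + real (s + 1 + j)) (m - s) =
      pochhammer (\<beta> + 1) m * pochhammer (real m + \<beta> + 1) j / (pochhammer (\<beta> + 1) s * pochhammer (\<beta> + real s + 1) j)"
  proof -
    have "pochhammer (\<beta> + 1) (m + j) = pochhammer (\<beta> + 1) m * pochhammer (real m + \<beta> + 1) j"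
      unfolding pochhammer_product' by (simp add: add_ac)
    moreover have "m + j = s + j + (m - s)" using s by simp
    then have "pochhammer (\<beta> + 1) (m + j) = 
       pochhammer (\<beta> + 1) s * pochhammer (\<beta> + real s + 1) j * pochhammer (\<beta> + real (s + 1 + j)) (m - s)"
      by (simp only: pochhammer_product') (simp add: add_ac)
    ultimately show ?thesis using pos by (simp add: field_simps)
  qed
  have p3: "fact (s + 1 + j) = fact (s + 1) * pochhammer (real s + 2) j"
    using fact_add_eq_pochhammer[of "s + 1" j] by (simp add: add_ac)
  have p4: "pochhammer (- real k) j = (-1) ^ j * fact k / fact (k - j)"
  proof -
    have "pochhammer (real (k - j) + 1) j * fact (k - j) = fact k"
      using fact_add_eq_pochhammer[of "k - j" j] j by simp
    then show ?thesis using j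
      by (simp add: pochhammer_minus' pochhammer_minus of_nat_diff field_simps)
  qed
  have p5: "real (m choose s) = (-1) ^ s * pochhammer (- real m) s / fact s"
    using gbinomial_pochhammer[of "real m" s] by (simp add: binomial_gbinomial)
  have sgn: "(-1 :: real) ^ (k - j) = (-1) ^ (k + j)"
    using j by (simp add: minus_one_power_iff)
  have p6: "fact s * real ((s + 1 + j - 1) choose s) = fact (s + j) / fact j"
    using falling_factorial_eq[of s j] by simp
  have "(-1) ^ (k - j) / (fact (s + 1 + j) * fact (k - j)) * monomial_coeff m \<beta> (s + 1 + j) s =
     (-1) ^ (k + j) / ((fact (s + 1) * pochhammer (real s + 2) j) * fact (k - j)) *
      ((fact m * pochhammer (real m + 1) s * pochhammer (real m + real s + 1) j / fact (s + j)) *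
       ((-1) ^ s * pochhammer (- real m) s / fact s * (fact (s + j) / fact j) *
        (pochhammer (\<beta> + 1) m * pochhammer (real m + \<beta> + 1) j / (pochhammer (\<beta> + 1) s * pochhammer (\<beta> + real s + 1) j))))"
    unfolding monomial_coeff_def by (simp only: p1 p2 p3 p5 p6 sgn)
  also have "\<dots> = - (fact m * pochhammer (\<beta> + 1) m * ((-1) ^ (s + 1 + k) * pochhammer (real m + 1) s * pochhammer (- real m) s /
        (pochhammer (\<beta> + 1) s * fact (s + 1) * fact s * fact k)) *
      (((-1) ^ j * fact k / fact (k - j)) * pochhammer (real m + \<beta> + 1) j * pochhammer (real m + real s + 1) j /
        (pochhammer (\<beta> + real s + 1) j * pochhammer (real s + 2) j * fact j)))"
    using pos by (simp add: field_simps power_add del: fact_Suc)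
  finally show ?thesis unfolding p4 .
qed

section \<open>The factorized form of the differential expression\<close>

text \<open>
  The right-hand side is what the differential expression gives on \<open>(t - x)\<^sup>i / i!\<close> at \<open>t = x\<close>,
  after expanding \<open>t - x = (t - 1) + (1 - x)\<close>. For a fixed \<open>s\<close>, all its terms carry the same power
  \<open>(x - 1)\<^bsup>i-s\<^esup>\<close>, so the inner sum over \<open>p\<close> is one coefficient of \<open>d_coeff\<close>, namely the one with
  \<open>k = i - 1 - s\<close>.
\<close>

lemma d_coeff_eq:
  assumes \<beta>: "\<beta> > -1" and i: "1 \<le> i"
  shows "d_coeff \<alpha> \<beta> i x = (\<Sum>p\<le>i. real (i choose p) * (1 - x) ^ (i - p) / fact i *
     (\<Sum>s\<le>\<alpha> + 2. monomial_coeff (\<alpha> + 2) \<beta> p s * 2 ^ s * (x - 1) ^ (p - s)))"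
proof -
  let ?m = "\<alpha> + 2"
  define A where "A = (\<lambda>p s. real (i choose p) * (1 - x) ^ (i - p) / fact i *
     (monomial_coeff ?m \<beta> p s * 2 ^ s * (x - 1) ^ (p - s)))"
  define B where "B = (\<lambda>k. (- 2) ^ i * pochhammer (real \<alpha> + 3) (i - 1 - k) * pochhammer (- real \<alpha> - 2) (i - 1 - k) /
          (pochhammer (\<beta> + 1) (i - 1 - k) * fact (i - k) * fact (i - 1 - k) * fact k) *
          hypergeom [- real k, real \<alpha> + \<beta> + 3, real \<alpha> + real i + 2 - real k]
                    [\<beta> + real i - real k, real i + 1 - real k] 1 *
          ((x - 1) / 2) ^ (k + 1))"
  have inner: "(\<Sum>p\<le>i. A p s) = - (fact ?m * pochhammer (\<beta> + 1) ?m * B (i - 1 - s))"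
    if s: "s \<in> {0..min (i - 1) ?m}" for s
  proof -
    define k where "k = i - 1 - s"
    have ik: "i = s + 1 + k" using s i by (auto simp: k_def)
    have sm: "s \<le> ?m" using s by simp
    have "(\<Sum>p\<le>i. A p s) = (\<Sum>p\<in>{s + 1..i}. A p s)"
      by (rule sum.mono_neutral_right) (auto simp: A_def monomial_coeff_eq_0)
    also have "\<dots> = (\<Sum>j\<le>k. A (s + 1 + j) s)"
      by (rule sum.reindex_bij_witness[of _ "\<lambda>j. s + 1 + j" "\<lambda>p. p - (s + 1)"]) (auto simp: ik)
    also have "\<dots> = (\<Sum>j\<le>k. (-1) ^ (k - j) / (fact (s + 1 + j) * fact (k - j)) * 
         monomial_coeff ?m \<beta> (s + 1 + j) s * (2 ^ s * (x - 1) ^ (k + 1)))"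
    proof (rule sum.cong[OF refl])
      fix j assume j: "j \<in> {..k}"
      have a: "i - (s + 1 + j) = k - j" "s + 1 + j - s = j + 1" using ik by auto
      have b: "real (i choose (s + 1 + j)) / fact i = 1 / (fact (s + 1 + j) * fact (k - j))"
        using j by (subst binomial_fact) (auto simp: a(1) ik)
      have c: "(1 - x) ^ (k - j) = (-1) ^ (k - j) * (x - 1) ^ (k - j)"
        by (metis minus_diff_eq mult_minus1 power_mult_distrib)
      have d: "(x - 1) ^ (k - j) * (x - 1) ^ (j + 1) = (x - 1) ^ (k + 1)"
        using j by (simp flip: power_add)
      have "A (s + 1 + j) s = (real (i choose (s + 1 + j)) / fact i) * (-1) ^ (k - j) *
          monomial_coeff ?m \<beta> (s + 1 + j) s * 2 ^ s * ((x - 1) ^ (k - j) * (x - 1) ^ (j + 1))"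
        by (simp only: A_def a c) (simp add: mult_ac)
      then show "A (s + 1 + j) s = (-1) ^ (k - j) / (fact (s + 1 + j) * fact (k - j)) * 
         monomial_coeff ?m \<beta> (s + 1 + j) s * (2 ^ s * (x - 1) ^ (k + 1))"
        unfolding b d by (simp add: mult_ac)
    qed
    also have "\<dots> = (\<Sum>j\<le>k. - (fact ?m * pochhammer (\<beta> + 1) ?m * ((-1) ^ (s + 1 + k) * pochhammer (real ?m + 1) s * pochhammer (- real ?m) s /
        (pochhammer (\<beta> + 1) s * fact (s + 1) * fact s * fact k)) *
      (pochhammer (- real k) j * pochhammer (real ?m + \<beta> + 1) j * pochhammer (real ?m + real s + 1) j /
        (pochhammer (\<beta> + real s + 1) j * pochhammer (real s + 2) j * fact j)))
        * (2 ^ s * (x - 1) ^ (k + 1)))"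
      by (rule sum.cong[OF refl], subst monomial_coeff_hypergeometric_term[OF \<beta> sm]) auto
    also have "\<dots> = - (fact ?m * pochhammer (\<beta> + 1) ?m * ((-1) ^ (s + 1 + k) * pochhammer (real ?m + 1) s * pochhammer (- real ?m) s /
        (pochhammer (\<beta> + 1) s * fact (s + 1) * fact s * fact k)) *
       (\<Sum>j\<le>k. pochhammer (- real k) j * pochhammer (real ?m + \<beta> + 1) j * pochhammer (real ?m + real s + 1) j /
        (pochhammer (\<beta> + real s + 1) j * pochhammer (real s + 2) j * fact j)) * (2 ^ s * (x - 1) ^ (k + 1)))"
      by (simp only: sum_distrib_left sum_distrib_right sum_negf[symmetric]) (simp add: mult_ac)
    also have "(\<Sum>j\<le>k. pochhammer (- real k) j * pochhammer (real ?m + \<beta> + 1) j * pochhammer (real ?m + real s + 1) j /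
        (pochhammer (\<beta> + real s + 1) j * pochhammer (real s + 2) j * fact j)) =
        hypergeom [- real k, real ?m + \<beta> + 1, real ?m + real s + 1] [\<beta> + real s + 1, real s + 2] 1"
      by (subst hypergeom_terminating[of k]) (auto simp: pochhammer_minus_nat_eq_0)
    also have "\<dots> = hypergeom [- real k, real \<alpha> + \<beta> + 3, real \<alpha> + real i + 2 - real k]
                    [\<beta> + real i - real k, real i + 1 - real k] 1"
      by (simp add: ik algebra_simps)
    also have "(2 :: real) ^ s * (x - 1) ^ (k + 1) = 2 ^ i * ((x - 1) / 2) ^ (k + 1)"
      by (simp add: ik power_add power_divide)
    finally have "(\<Sum>p\<le>i. A p s) = - (fact ?m * pochhammer (\<beta> + 1) ?m *
       (((- 1) ^ i * 2 ^ i) * pochhammer (real \<alpha> + 3) s * pochhammer (- real \<alpha> - 2) s /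
          (pochhammer (\<beta> + 1) s * fact (s + 1) * fact s * fact k) *
          hypergeom [- real k, real \<alpha> + \<beta> + 3, real \<alpha> + real i + 2 - real k]
                    [\<beta> + real i - real k, real i + 1 - real k] 1 *
          ((x - 1) / 2) ^ (k + 1)))"
      by (simp add: ik algebra_simps del: fact_Suc)
    moreover have "i - 1 - k = s" "i - k = s + 1" "(-1) ^ i * 2 ^ i = (- 2 :: real) ^ i"
      by (simp_all add: ik flip: power_mult_distrib)
    ultimately show ?thesis
      unfolding k_def[symmetric] B_def by (simp only:)
  qed
  have "(\<Sum>p\<le>i. real (i choose p) * (1 - x) ^ (i - p) / fact i *
     (\<Sum>s\<le>?m. monomial_coeff ?m \<beta> p s * 2 ^ s * (x - 1) ^ (p - s))) = (\<Sum>s\<le>?m. \<Sum>p\<le>i. A p s)"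
    unfolding A_def sum_distrib_left by (rule sum.swap)
  also have "\<dots> = (\<Sum>s\<in>{0..min (i - 1) ?m}. \<Sum>p\<le>i. A p s)"
    by (rule sum.mono_neutral_right) (use i in \<open>auto simp: A_def not_le monomial_coeff_eq_0 intro!: sum.neutral\<close>)
  also have "\<dots> = (\<Sum>s\<in>{0..min (i - 1) ?m}. - (fact ?m * pochhammer (\<beta> + 1) ?m * B (i - 1 - s)))"
    by (rule sum.cong[OF refl inner])
  also have "\<dots> = (\<Sum>k = i - (\<alpha> + 3)..i - 1. - (fact ?m * pochhammer (\<beta> + 1) ?m * B k))"
    by (rule sum.reindex_bij_witness[of _ "\<lambda>k. i - 1 - k" "\<lambda>s. i - 1 - s"]) auto
  also have "\<dots> = d_coeff \<alpha> \<beta> i x"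
    unfolding d_coeff_def B_def[symmetric] by (simp only: sum_distrib_left sum_negf)
  finally show ?thesis by simp
qed

text \<open>
  Replace \<open>y\<close> by its Taylor polynomial \<open>T\<close> at \<open>x\<close>. By linearity the coefficient of the \<open>i\<close>-th
  derivative of \<open>y\<close> at \<open>x\<close> is the value on \<open>(t - x)\<^sup>i / i!\<close>, which \<open>d_coeff_eq\<close> identifies. There is no
  term of order 0 because constants are annihilated.
\<close>

lemma L_expr_eq:
  assumes \<beta>: "\<beta> > -1" and y: "times_differentiable_on (2 * \<alpha> + 4) y {-1<..<1}" and x: "x \<in> {-1<..<1}"
  shows "L_expr \<alpha> \<beta> y x = (x - 1) / (x + 1) powr \<beta> * Jacobi_weighted_op \<alpha> \<beta> y x"
proof -
  let ?S = "{-1<..<1 :: real}" and ?m = "\<alpha> + 2"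
  let ?c = "(x - 1) / (x + 1) powr \<beta>"
  let ?w = "\<lambda>t. (t + 1) powr (real \<alpha> + \<beta> + 2)" and ?v = "\<lambda>s :: real. (s - 1) ^ (\<alpha> + 1)"
  note tdo = times_differentiable_on_power_shift[OF open_greaterThanLessThan]
  have S: "open ?S" by simp
  have w: "times_differentiable_on k ?w ?S" for k
    by (rule times_differentiable_on_powr_shift) auto
  have order: "2 * ?m = 2 * \<alpha> + 4" by simp
  have y': "times_differentiable_on (2 * ?m) y ?S"
    using y unfolding order .
  have lin: "Jacobi_weighted_op \<alpha> \<beta> (\<lambda>s. \<Sum>i\<in>I. c i * f i s) x = (\<Sum>i\<in>I. c i * Jacobi_weighted_op \<alpha> \<beta> (f i) x)"
    if "\<And>i. i \<in> I \<Longrightarrow> times_differentiable_on (2 * ?m) (f i) ?S" for I :: "nat set" and c f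
    unfolding Jacobi_weighted_op_def
    by (rule weighted_higher_deriv_linear_combination[OF S x tdo w that])
  define T where "T = (\<lambda>t. \<Sum>i\<le>2 * ?m. (deriv ^^ i) y x / fact i * (t - x) ^ i)"
  have T: "times_differentiable_on k T ?S" for k
    unfolding T_def by (intro times_differentiable_on_linear_combination tdo S)
  have jet: "(deriv ^^ j) y x = (deriv ^^ j) T x" if "j \<le> 2 * ?m" for j
  proof -
    have "(deriv ^^ j) T x = (\<Sum>i\<le>2 * ?m. (deriv ^^ i) y x / fact i * (deriv ^^ j) (\<lambda>t. (t - x) ^ i) x)"
      unfolding T_def by (rule higher_deriv_linear_combination[OF S tdo order_refl x])
    also have "\<dots> = (\<Sum>i\<le>2 * ?m. if i = j then (deriv ^^ j) y x else 0)"
    proof (rule sum.cong[OF refl])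
      fix i
      show "(deriv ^^ i) y x / fact i * (deriv ^^ j) (\<lambda>t. (t - x) ^ i) x =
          (if i = j then (deriv ^^ j) y x else 0)"
        using higher_deriv_power_shift[OF S x, of j x i]
        by (cases i j rule: linorder_cases) (auto simp: power_0_left binomial_eq_0)
    qed
    also have "\<dots> = (deriv ^^ j) y x" using that by simp
    finally show ?thesis ..
  qed
  have mono: "?c * Jacobi_weighted_op \<alpha> \<beta> (\<lambda>t. (t - x) ^ i) x = 
      (if i = 0 then 0 else fact i * d_coeff \<alpha> \<beta> i x)" for i
  proof -
    have "(\<lambda>t. (t - x) ^ i) = (\<lambda>t. \<Sum>p\<le>i. real (i choose p) * (1 - x) ^ (i - p) * (t - 1) ^ p)"
    proof
      fix t
      have "t - x = (t - 1) + (1 - x)" by simp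
      then show "(t - x) ^ i = (\<Sum>p\<le>i. real (i choose p) * (1 - x) ^ (i - p) * (t - 1) ^ p)"
        by (simp only: binomial_ring) (simp add: mult_ac)
    qed
    then have "?c * Jacobi_weighted_op \<alpha> \<beta> (\<lambda>t. (t - x) ^ i) x = 
      (\<Sum>p\<le>i. real (i choose p) * (1 - x) ^ (i - p) * (?c * Jacobi_weighted_op \<alpha> \<beta> (\<lambda>t. (t - 1) ^ p) x))"
      by (simp only: lin[OF tdo] sum_distrib_left) (simp add: mult_ac)
    also have "\<dots> = (\<Sum>p\<le>i. real (i choose p) * (1 - x) ^ (i - p) *
        (\<Sum>s\<le>?m. monomial_coeff ?m \<beta> p s * 2 ^ s * (x - 1) ^ (p - s)))"
      by (simp only: Jacobi_weighted_op_monomial[OF x])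
    also have "\<dots> = (if i = 0 then 0 else fact i * d_coeff \<alpha> \<beta> i x)"
    proof (cases "i = 0")
      case False
      then show ?thesis by (simp add: d_coeff_eq[OF \<beta>] sum_distrib_left)
    qed (simp add: monomial_coeff_eq_0)
    finally show ?thesis .
  qed
  have "Jacobi_weighted_op \<alpha> \<beta> y x = Jacobi_weighted_op \<alpha> \<beta> T x"
    unfolding Jacobi_weighted_op_def
    by (rule weighted_higher_deriv_cong_jet[OF S x tdo w y' T jet])
  also have "\<dots> = (\<Sum>i\<le>2 * ?m. (deriv ^^ i) y x / fact i * Jacobi_weighted_op \<alpha> \<beta> (\<lambda>t. (t - x) ^ i) x)"
    unfolding T_def by (rule lin[OF tdo])
  finally have "?c * Jacobi_weighted_op \<alpha> \<beta> y x = 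
      (\<Sum>i\<le>2 * ?m. (deriv ^^ i) y x / fact i * (?c * Jacobi_weighted_op \<alpha> \<beta> (\<lambda>t. (t - x) ^ i) x))"
    by (simp only: sum_distrib_left) (simp add: mult_ac)
  also have "\<dots> = (\<Sum>i\<le>2 * ?m. if i = 0 then 0 else d_coeff \<alpha> \<beta> i x * (deriv ^^ i) y x)"
    by (rule sum.cong[OF refl]) (simp only: mono, simp)
  also have "\<dots> = (\<Sum>i = 1..2 * \<alpha> + 4. d_coeff \<alpha> \<beta> i x * (deriv ^^ i) y x)"
    by (rule sum.mono_neutral_cong_right) auto
  finally show ?thesis by (simp add: L_expr_def)
qed

section \<open>Relations between Jacobi polynomials\<close>

definition Jacobi_coeff :: "real \<Rightarrow> real \<Rightarrow> nat \<Rightarrow> nat \<Rightarrow> real" where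
  "Jacobi_coeff a b n k = pochhammer (a + 1) n / fact n *
     (pochhammer (- real n) k * pochhammer (real n + a + b + 1) k / (pochhammer (a + 1) k * fact k)) * (-1) ^ k"

text \<open>
  The variable of this polynomial is \<open>u = (x - 1) / 2\<close>, the one in which the hypergeometric series is a
  power series. Relations between Jacobi polynomials become relations between coefficients, and
  \<open>x - 1\<close> and \<open>x + 1\<close> times differentiation in \<open>x\<close> become \<open>u\<close> and \<open>1 + u\<close> times differentiation in \<open>u\<close>.
\<close>

definition Jacobi_poly :: "real \<Rightarrow> real \<Rightarrow> nat \<Rightarrow> real poly" where
  "Jacobi_poly a b n = (\<Sum>k\<le>n. monom (Jacobi_coeff a b n k) k)"

lemma coeff_Jacobi_poly [simp]: "coeff (Jacobi_poly a b n) k = Jacobi_coeff a b n k"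
  by (cases "k \<le> n") (auto simp: Jacobi_poly_def coeff_sum Jacobi_coeff_def pochhammer_minus_nat_eq_0)

lemma Jacobi_P_eq_poly: "Jacobi_P a b n x = poly (Jacobi_poly a b n) ((x - 1) / 2)"
proof -
  have *: "(1 - x) / 2 = (-1) * ((x - 1) / 2)" by simp
  show ?thesis
    unfolding Jacobi_P_def * Jacobi_poly_def poly_sum poly_monom Jacobi_coeff_def
    by (subst hypergeom_terminating[of n])
       (simp_all only: power_mult_distrib, simp_all add: pochhammer_minus_nat_eq_0 sum_distrib_left mult_ac)
qed

lemma pochhammer_shift_pos:
  "z > 0 \<Longrightarrow> pochhammer (z + 1) n = pochhammer z n * (z + real n) / (z :: real)"
  using pochhammer_rec[of z n] by (simp add: pochhammer_Suc field_simps)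

lemma Jacobi_coeff_Suc:
  assumes "a > -1"
  shows "(real k + 1) * (real k + a + 1) * Jacobi_coeff a b n (Suc k) =
         (real n - real k) * (real n + real k + a + b + 1) * Jacobi_coeff a b n k"
proof -
  define q where "q = real k + a + 1"
  define Z where "Z = pochhammer (a + 1) k"
  have pos: "Z > 0" "q > 0"
    using assms by (auto intro!: pochhammer_pos simp: Z_def q_def)
  have q: "a + 1 + real k = q" "real n + a + b + 1 + real k = real n + real k + a + b + 1" 
    by (simp_all add: q_def)
  show ?thesis
    unfolding Jacobi_coeff_def pochhammer_Suc Z_def[symmetric] q q_def[symmetric] 
      fact_Suc power_Suc of_nat_mult
    using pos by (simp add: divide_simps) (simp add: algebra_simps)
qed

lemma Jacobi_coeff_shift:
  assumes "a > -1"
  shows "(real k + a + 1) * Jacobi_coeff (a + 1) b n k = (real n + a + 1) * Jacobi_coeff a (b + 1) n k"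
proof -
  define p q r where "p = a + 1" "q = real k + a + 1" "r = real n + a + 1"
  define Z where "Z = pochhammer (a + 1) k"
  have pos: "Z > 0" "q > 0" "p > 0"
    using assms by (auto intro!: pochhammer_pos simp: Z_def p_q_r_def)
  have e: "real n + (a + 1) + b + 1 = real n + a + (b + 1) + 1" 
    "pochhammer (a + 1 + 1) n = pochhammer (a + 1) n * r / p"
    "pochhammer (a + 1 + 1) k = Z * q / p"
    using pochhammer_shift_pos[of "a + 1"] assms by (simp_all add: p_q_r_def Z_def add_ac)
  show ?thesis
    unfolding Jacobi_coeff_def e Z_def[symmetric] p_q_r_def(2,3)[symmetric]
    using pos by simp
qed

lemma Jacobi_coeff_deriv:
  assumes "a > -1"
  shows "(real k + 1) * Jacobi_coeff a b (Suc n) (Suc k) =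
         (real n + a + b + 2) * Jacobi_coeff (a + 1) (b + 1) n k"
proof -
  define p where "p = a + 1"
  define Z where "Z = pochhammer (a + 1 + 1) k"
  have pos: "Z > 0" "p > 0"
    using assms by (auto intro!: pochhammer_pos simp: Z_def p_def)
  have e: "- real (Suc n) + 1 = - real n" "real n + a + b + 2 + 1 = real n + (a + 1) + (b + 1) + 1"
     "real (Suc n) + a + b + 1 = real n + a + b + 2"
    by simp_all
  define U X Y where "U = pochhammer (a + 1 + 1) n" "X = pochhammer (- real n) k"
    "Y = pochhammer (real n + (a + 1) + (b + 1) + 1) k"
  show ?thesis
    unfolding Jacobi_coeff_def pochhammer_rec[of _ k] pochhammer_rec[of _ n] e fact_Suc power_Suc of_nat_mult
    unfolding Z_def[symmetric] U_X_Y_def[symmetric]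
    unfolding p_def[symmetric]
    using pos by (simp add: divide_simps) (simp add: algebra_simps)
qed

lemma DERIV_poly_scaled:
  "((\<lambda>x. poly p ((x - 1) / 2)) has_real_derivative poly (pderiv p) ((x - 1) / 2) / 2) (at x)"
  by (rule DERIV_cong[OF DERIV_chain'[where f = "\<lambda>x. (x - 1) / 2", OF _ poly_DERIV]])
     (auto intro!: derivative_eq_intros)

lemma deriv_poly_scaled:
  fixes p :: "real poly"
  shows
  "deriv (\<lambda>x. poly p ((x - 1) / 2)) = (\<lambda>x. poly (pderiv p) ((x - 1) / 2) / 2)"
  using DERIV_poly_scaled by (auto intro!: DERIV_imp_deriv)

lemma times_differentiable_on_poly_scaled:
  assumes "open S"
  shows "times_differentiable_on k (\<lambda>x. poly p ((x - 1) / 2)) S"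
  by (rule times_differentiable_on_chain[where g = "\<lambda>j x. poly ((pderiv ^^ j) p) ((x - 1) / 2) / 2 ^ j", OF assms])
     (auto intro!: derivative_eq_intros DERIV_poly_scaled)

lemma Jacobi_P_poly_fun: "Jacobi_P a b n = (\<lambda>x. poly (Jacobi_poly a b n) ((x - 1) / 2))"
  by (simp add: fun_eq_iff Jacobi_P_eq_poly)

lemma DERIV_Jacobi_P: "(Jacobi_P a b n has_real_derivative deriv (Jacobi_P a b n) x) (at x)"
  unfolding Jacobi_P_poly_fun deriv_poly_scaled by (rule DERIV_poly_scaled)

text \<open>
  In terms of \<open>u\<close>, the operator \<open>u D + a + 1\<close> multiplies \<open>u\<^sup>k\<close> by \<open>k + a + 1\<close>, which is how the coefficients of
  the two polynomials differ. Equivalently, differentiating \<open>(x - 1)\<^bsup>a+1\<^esup> P\<close> lowers the first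
  parameter and raises the second.
\<close>

lemma Jacobi_P_lower:
  assumes "a > -1"
  shows "(x - 1) * deriv (Jacobi_P (a + 1) b n) x + (a + 1) * Jacobi_P (a + 1) b n x =
         (real n + a + 1) * Jacobi_P a (b + 1) n x"
proof -
  let ?p = "Jacobi_poly (a + 1) b n"
  have "pCons 0 (pderiv ?p) + smult (a + 1) ?p = smult (real n + a + 1) (Jacobi_poly a (b + 1) n)"
    (is "?l = ?r")
  proof (rule poly_eqI)
    fix k
    have "coeff ?l k = (real k + a + 1) * Jacobi_coeff (a + 1) b n k"
      by (cases k) (simp_all add: coeff_pderiv algebra_simps)
    then show "coeff ?l k = coeff ?r k"
      using Jacobi_coeff_shift[OF assms] by simp
  qed
  from arg_cong[OF this, of "\<lambda>p. poly p ((x - 1) / 2)"] show ?thesis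
    unfolding Jacobi_P_poly_fun deriv_poly_scaled by simp
qed

text \<open>
  The counterpart at \<open>x = -1\<close>: differentiating \<open>(x + 1)\<^bsup>b+1\<^esup> P\<close> raises the first parameter and lowers
  the second. Here two neighbouring coefficients interact, and their ratio \<open>Jacobi_coeff_Suc\<close> reduces
  the claim to \<open>Jacobi_coeff_shift\<close>.
\<close>

lemma Jacobi_P_raise:
  assumes "a > -1"
  shows "(x + 1) * deriv (Jacobi_P a (b + 1) n) x + (b + 1) * Jacobi_P a (b + 1) n x =
         (real n + b + 1) * Jacobi_P (a + 1) b n x"
proof -
  let ?p = "Jacobi_poly a (b + 1) n"
  have "pderiv ?p + pCons 0 (pderiv ?p) + smult (b + 1) ?p = smult (real n + b + 1) (Jacobi_poly (a + 1) b n)"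
    (is "?l = ?r")
  proof (rule poly_eqI)
    fix k
    let ?c = "Jacobi_coeff a (b + 1) n"
    have pos: "real k + a + 1 > 0" using assms by simp
    have "coeff ?l k = (real k + 1) * ?c (Suc k) + (real k + b + 1) * ?c k"
      by (cases k) (simp_all add: coeff_pderiv algebra_simps)
    then have "(real k + a + 1) * coeff ?l k = 
        (real k + 1) * (real k + a + 1) * ?c (Suc k) + (real k + b + 1) * (real k + a + 1) * ?c k"
      by (simp add: algebra_simps)
    also have "\<dots> = (real n + b + 1) * ((real n + a + 1) * ?c k)"
      unfolding Jacobi_coeff_Suc[OF assms] by (simp add: algebra_simps)
    also have "\<dots> = (real k + a + 1) * coeff ?r k"
      unfolding Jacobi_coeff_shift[OF assms, symmetric] by simp
    finally show "coeff ?l k = coeff ?r k" using pos by simp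
  qed
  from arg_cong[OF this, of "\<lambda>p. poly p ((x - 1) / 2)"] show ?thesis
    unfolding Jacobi_P_poly_fun deriv_poly_scaled by (simp add: field_simps)
qed

lemma deriv_Jacobi_P_Suc:
  assumes "a > -1"
  shows "deriv (Jacobi_P a b (Suc n)) x = (real n + a + b + 2) / 2 * Jacobi_P (a + 1) (b + 1) n x"
proof -
  have "pderiv (Jacobi_poly a b (Suc n)) = smult (real n + a + b + 2) (Jacobi_poly (a + 1) (b + 1) n)"
    by (rule poly_eqI) (use Jacobi_coeff_deriv[OF assms] in \<open>simp add: coeff_pderiv add_ac\<close>)
  from arg_cong[OF this, of "\<lambda>p. poly p ((x - 1) / 2)"] show ?thesis
    unfolding Jacobi_P_poly_fun deriv_poly_scaled by simp
qed

text \<open>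
  The combination of \<open>Q\<close> and its derivative on the right is, up to a factor, what the differential
  expression yields on \<open>P\<^sub>n\<^sub>+\<^sub>1\<close>. This relation therefore says that \<open>P\<^sub>n\<^sub>+\<^sub>1\<close> fails to be an eigenfunction
  by a multiple of \<open>Q\<close> only.
\<close>

lemma Jacobi_P_contiguous:
  fixes a b :: real and n :: nat
  assumes "a > -1"
  defines "Q \<equiv> Jacobi_P (a + 2) b n"
  shows "(real n + 1) * (real n + a + 2) * Jacobi_P a b (Suc n) x = 
     (a + 2) * (a + 1) * Q x + (x - 1) / 2 * ((real n + 1) * (real n + a + b + 2) * Q x + 
       (a + 1) * ((x + 1) * deriv Q x + (a + b + 2) * Q x))"
proof -
  let ?q = "Jacobi_poly (a + 2) b n" and ?c = "Jacobi_coeff (a + 2) b n"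
  have "smult ((real n + 1) * (real n + a + 2)) (Jacobi_poly a b (Suc n)) =
    smult ((a + 2) * (a + 1)) ?q + pCons 0 (smult ((real n + 1) * (real n + a + b + 2)) ?q +
      smult (a + 1) (pderiv ?q + pCons 0 (pderiv ?q) + smult (a + b + 2) ?q))" (is "?l = ?r")
  proof (rule poly_eqI)
    fix k
    show "coeff ?l k = coeff ?r k"
    proof (cases k)
      case 0
      have p: "a + 1 > 0" "a + 2 > 0" using assms by simp_all
      have "(real n + a + 2) * pochhammer (a + 1) (Suc n) = pochhammer (a + 1) (Suc (Suc n))"
        by (simp add: pochhammer_Suc algebra_simps)
      also have "\<dots> = (a + 1) * (a + 2) * pochhammer (a + 3) n"
        unfolding pochhammer_rec by (simp add: algebra_simps)
      finally show ?thesis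
        using 0 by (simp add: Jacobi_coeff_def add_ac del: pochhammer_Suc)
    next
      case (Suc k)
      have pos: "real n + a + 2 > 0" "real k + 1 > 0" using assms by simp_all
      have a1: "a + 1 > -1" "a + 2 > -1" using assms by simp_all
      \<comment> \<open>After multiplication by \<open>k + 1\<close>, both sides become multiples of the single coefficient \<open>?c k\<close>.\<close>
      have c1: "coeff ?r (Suc k) = (a + 1) * (real k + a + 3) * ?c (Suc k) + 
         ((real n + 1) * (real n + a + b + 2) + (a + 1) * (real k + a + b + 2)) * ?c k"
        by (cases k) (simp_all add: coeff_pderiv algebra_simps)
      have R: "(real k + 1) * (real k + a + 3) * ?c (Suc k) = 
         (real n - real k) * (real n + real k + a + b + 3) * ?c k"
        using Jacobi_coeff_Suc[OF a1(2), of k b n] by (simp add: add_ac)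
      have S: "(real n + a + 2) * Jacobi_coeff (a + 1) (b + 1) n k = (real k + a + 2) * ?c k"
        using Jacobi_coeff_shift[OF a1(1), of k b n] by (simp add: add_ac)
      have "(real k + 1) * coeff ?l (Suc k) = 
         (real n + 1) * (real n + a + 2) * ((real k + 1) * Jacobi_coeff a b (Suc n) (Suc k))"
        by simp
      also have "\<dots> = (real n + 1) * (real n + a + b + 2) * ((real n + a + 2) * Jacobi_coeff (a + 1) (b + 1) n k)"
        unfolding Jacobi_coeff_deriv[OF assms(1)] by simp
      also have "\<dots> = (a + 1) * ((real n - real k) * (real n + real k + a + b + 3) * ?c k) +
         (real k + 1) * ((real n + 1) * (real n + a + b + 2) + (a + 1) * (real k + a + b + 2)) * ?c k"
        unfolding S by (simp add: algebra_simps)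
      also have "\<dots> = (real k + 1) * coeff ?r (Suc k)"
        unfolding R[symmetric] c1 by (simp add: algebra_simps)
      finally show ?thesis using pos Suc by simp
    qed
  qed
  from arg_cong[OF this, of "\<lambda>p. poly p ((x - 1) / 2)"] show ?thesis
    unfolding Q_def Jacobi_P_poly_fun deriv_poly_scaled by (simp add: field_simps)
qed

text \<open>
  The Jacobi differential operator in the variable \<open>u = (x - 1) / 2\<close>; see \<open>deriv_Jacobi_operator\<close> for its
  self-adjoint form in \<open>x\<close>.
\<close>

definition Jacobi_operator :: "real \<Rightarrow> real \<Rightarrow> real poly \<Rightarrow> real poly" where
  "Jacobi_operator a b p = [:0, 1, 1:] * pderiv (pderiv p) + [:a + 1, a + b + 2:] * pderiv p"

text \<open>
  Jacobi's differential equation is the two-term recurrence \<open>Jacobi_coeff_Suc\<close>, since the operator maps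
  \<open>u\<^sup>k\<close> to \<open>k (k + a + b + 1) u\<^sup>k + k (k + a) u\<^bsup>k-1\<^esup>\<close>.
\<close>

lemma Jacobi_operator_eigen:
  assumes "a > -1"
  shows "Jacobi_operator a b (Jacobi_poly a b n) = smult (real n * (real n + a + b + 1)) (Jacobi_poly a b n)"
proof (rule poly_eqI)
  fix k
  let ?c = "Jacobi_coeff a b n"
  have "coeff (Jacobi_operator a b (Jacobi_poly a b n)) k = 
     (real k + 1) * (real k + a + 1) * ?c (Suc k) + real k * (real k + a + b + 1) * ?c k"
  proof (cases k)
    case (Suc j)
    then show ?thesis
      by (cases j) (simp_all add: Jacobi_operator_def coeff_pderiv algebra_simps)
  qed (simp add: Jacobi_operator_def coeff_pderiv)
  then show "coeff (Jacobi_operator a b (Jacobi_poly a b n)) k = 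
      coeff (smult (real n * (real n + a + b + 1)) (Jacobi_poly a b n)) k"
    unfolding Jacobi_coeff_Suc[OF assms] by (simp add: algebra_simps)
qed

text \<open>
  Conjugating the operator with the factor \<open>u\<close> turns its parameter \<open>a\<close> into \<open>a + 2\<close>, apart from a constant and
  the extra term \<open>(a + 1) q\<close> that stems from differentiating \<open>u\<close> itself. Hence \<open>u q\<close> belongs to the
  eigenvalue of degree \<open>n + 1\<close>, up to a multiple of \<open>q\<close>.
\<close>

lemma Jacobi_operator_shifted:
  assumes "a > -1"
  shows "Jacobi_operator a b (pCons 0 (Jacobi_poly (a + 2) b n)) = 
    smult ((real n + 1) * (real n + a + b + 2)) (pCons 0 (Jacobi_poly (a + 2) b n)) + 
    smult (a + 1) (Jacobi_poly (a + 2) b n)"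
proof (rule poly_eqI)
  fix k
  let ?c = "Jacobi_coeff (a + 2) b n"
  let ?q = "Jacobi_poly (a + 2) b n"
  have "Jacobi_operator a b (pCons 0 ?q) = 
     pCons 0 (Jacobi_operator (a + 2) b ?q + smult (a + b + 2) ?q) + smult (a + 1) ?q"
    unfolding poly_eq_poly_eq_iff[symmetric]
    by (rule ext) (simp add: Jacobi_operator_def pderiv_pCons pderiv_add algebra_simps)
  also have "Jacobi_operator (a + 2) b ?q = smult (real n * (real n + (a + 2) + b + 1)) ?q"
    by (rule Jacobi_operator_eigen) (use assms in simp)
  finally show "coeff (Jacobi_operator a b (pCons 0 ?q)) k = coeff (
    smult ((real n + 1) * (real n + a + b + 2)) (pCons 0 ?q) + smult (a + 1) ?q) k"
    by (simp add: coeff_pCons algebra_simps split: nat.splits)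
qed

lemma deriv_Jacobi_operator:
  assumes x: "x > -1"
  shows "deriv (\<lambda>t. (t - 1) ^ (\<alpha> + 1) * (t + 1) powr (\<beta> + 1) * 
           deriv (\<lambda>x. poly p ((x - 1) / 2)) t) x =
     (x - 1) ^ \<alpha> * (x + 1) powr \<beta> * poly (Jacobi_operator (real \<alpha>) \<beta> p) ((x - 1) / 2)"
proof (rule DERIV_imp_deriv)
  let ?p1 = "poly (pderiv p) ((x - 1) / 2)" and ?p2 = "poly (pderiv (pderiv p)) ((x - 1) / 2)"
  have powr: "(x + 1) powr (\<beta> + 1) = (x + 1) * (x + 1) powr \<beta>"
    using x by (simp add: powr_add)
  have pw: "((\<lambda>t. (t - 1) ^ (\<alpha> + 1)) has_real_derivative (real \<alpha> + 1) * (x - 1) ^ \<alpha>) (at x)"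
    by (rule derivative_eq_intros refl)+ simp
  have pr: "((\<lambda>t. (t + 1) powr (\<beta> + 1)) has_real_derivative (\<beta> + 1) * (x + 1) powr \<beta>) (at x)"
    using x by (auto intro!: derivative_eq_intros)
  have "((\<lambda>t. (t - 1) ^ (\<alpha> + 1) * (t + 1) powr (\<beta> + 1) * (poly (pderiv p) ((t - 1) / 2) / 2)) 
     has_real_derivative ((real \<alpha> + 1) * (x - 1) ^ \<alpha> * (x + 1) powr (\<beta> + 1) + 
        (x - 1) ^ (\<alpha> + 1) * ((\<beta> + 1) * (x + 1) powr \<beta>)) * (?p1 / 2) +
       (x - 1) ^ (\<alpha> + 1) * (x + 1) powr (\<beta> + 1) * (?p2 / 2 / 2)) (at x)"
    by (rule DERIV_cong[OF DERIV_mult[OF DERIV_mult[OF pw pr] DERIV_cdivide[OF DERIV_poly_scaled]]])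
       (simp add: algebra_simps)
  also have "((real \<alpha> + 1) * (x - 1) ^ \<alpha> * (x + 1) powr (\<beta> + 1) + 
        (x - 1) ^ (\<alpha> + 1) * ((\<beta> + 1) * (x + 1) powr \<beta>)) * (?p1 / 2) +
       (x - 1) ^ (\<alpha> + 1) * (x + 1) powr (\<beta> + 1) * (?p2 / 2 / 2) =
     (x - 1) ^ \<alpha> * (x + 1) powr \<beta> * poly (Jacobi_operator (real \<alpha>) \<beta> p) ((x - 1) / 2)"
    unfolding powr by (simp add: Jacobi_operator_def field_simps)
  finally show "((\<lambda>t. (t - 1) ^ (\<alpha> + 1) * (t + 1) powr (\<beta> + 1) * 
           deriv (\<lambda>x. poly p ((x - 1) / 2)) t) has_real_derivative 
     (x - 1) ^ \<alpha> * (x + 1) powr \<beta> * poly (Jacobi_operator (real \<alpha>) \<beta> p) ((x - 1) / 2)) (at x)"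
    unfolding deriv_poly_scaled .
qed

section \<open>The differential expression on Jacobi polynomials\<close>

lemma times_differentiable_on_Jacobi_P: 
  "open S \<Longrightarrow> times_differentiable_on k (Jacobi_P a b n) S"
  unfolding Jacobi_P_poly_fun by (rule times_differentiable_on_poly_scaled)

lemma higher_deriv_linear_combination2:
  assumes S: "open S" "x \<in> S" and f: "times_differentiable_on k f S" and g: "times_differentiable_on k g S"
    and "j \<le> k"
  shows "(deriv ^^ j) (\<lambda>x. a * f x + b * g x) x = a * (deriv ^^ j) f x + b * (deriv ^^ j) g x"
  using higher_deriv_linear_combination[OF S(1), of "UNIV :: bool set" k "\<lambda>i. if i then f else g" j x
      "\<lambda>i. if i then a else b"] assms
  by (simp add: UNIV_bool add.commute)

text \<open>
  The exponent of \<open>x - 1\<close> equals the first parameter and drops with it at every differentiation, so the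
  lowering relation applies \<open>j\<close> times.
\<close>

lemma higher_deriv_power_mult_Jacobi_P:
  "(deriv ^^ j) (\<lambda>x. (x - 1) ^ (i + j) * Jacobi_P (real i + real j) b n x) =
     (\<lambda>x. pochhammer (real n + real i + 1) j * ((x - 1) ^ i * Jacobi_P (real i) (b + real j) n x))"
proof (induction j arbitrary: i)
  case (Suc j)
  have IH: "(deriv ^^ j) (\<lambda>x. (x - 1) ^ (i + Suc j) * Jacobi_P (real i + real (Suc j)) b n x) =
     (\<lambda>x. pochhammer (real n + real i + 2) j * ((x - 1) ^ Suc i * Jacobi_P (real i + 1) (b + real j) n x))"
    using Suc.IH[of "Suc i"] by (simp add: add_ac)
  have step: "deriv (\<lambda>x. pochhammer (real n + real i + 2) j * 
       ((x - 1) ^ Suc i * Jacobi_P (real i + 1) (b + real j) n x)) x =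
     pochhammer (real n + real i + 1) (Suc j) * ((x - 1) ^ i * Jacobi_P (real i) (b + real (Suc j)) n x)" for x
  proof (rule DERIV_imp_deriv)
    let ?P = "Jacobi_P (real i + 1) (b + real j) n"
    have "((\<lambda>x. pochhammer (real n + real i + 2) j * ((x - 1) ^ Suc i * ?P x)) has_real_derivative
       pochhammer (real n + real i + 2) j * (x - 1) ^ i * ((x - 1) * deriv ?P x + (real i + 1) * ?P x)) (at x)"
      by (rule derivative_eq_intros DERIV_Jacobi_P refl)+ (simp add: algebra_simps)
    also have "(x - 1) * deriv ?P x + (real i + 1) * ?P x = 
       (real n + real i + 1) * Jacobi_P (real i) (b + real (Suc j)) n x"
      using Jacobi_P_lower[of "real i" x "b + real j" n] by (simp add: add_ac)
    also have "pochhammer (real n + real i + 2) j * (x - 1) ^ i * 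
       ((real n + real i + 1) * Jacobi_P (real i) (b + real (Suc j)) n x) =
       pochhammer (real n + real i + 1) (Suc j) * ((x - 1) ^ i * Jacobi_P (real i) (b + real (Suc j)) n x)"
      using pochhammer_rec[of "real n + real i + 1" j] by (simp add: add_ac mult_ac)
    finally show "((\<lambda>x. pochhammer (real n + real i + 2) j * ((x - 1) ^ Suc i * ?P x)) has_real_derivative
       pochhammer (real n + real i + 1) (Suc j) * ((x - 1) ^ i * Jacobi_P (real i) (b + real (Suc j)) n x)) (at x)" .
  qed
  show ?case unfolding funpow.simps o_apply IH by (rule ext) (rule step)
qed simp

text \<open>
  The analogue at \<open>x = -1\<close>: now the exponent of \<open>x + 1\<close> follows the second parameter, and the raising
  relation applies \<open>j\<close> times.
\<close>

lemma higher_deriv_powr_mult_Jacobi_P: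
  assumes "x > -1" "a > -1"
  shows "(deriv ^^ j) (\<lambda>x. (x + 1) powr (b + real j) * Jacobi_P a (b + real j) n x) x =
     pochhammer (real n + b + 1) j * ((x + 1) powr b * Jacobi_P (a + real j) b n x)"
  using assms(1)
proof (induction j arbitrary: b x)
  case (Suc j)
  let ?P = "Jacobi_P (a + real j) (b + 1) n"
  let ?f = "\<lambda>x. pochhammer (real n + b + 2) j * ((x + 1) powr (b + 1) * ?P x)"
  have eq: "?f t = (deriv ^^ j) (\<lambda>x. (x + 1) powr (b + real (Suc j)) * Jacobi_P a (b + real (Suc j)) n x) t" 
    if "t > -1" for t
    using Suc.IH[OF that, of "b + 1"] by (simp add: add_ac)
  have "(?f has_real_derivative pochhammer (real n + b + 2) j * (x + 1) powr b * 
      ((x + 1) * deriv ?P x + (b + 1) * ?P x)) (at x)"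
  proof -
    have "((\<lambda>x. (x + 1) powr (b + 1)) has_real_derivative (b + 1) * (x + 1) powr b) (at x)"
      using Suc.prems by (auto intro!: derivative_eq_intros)
    from DERIV_cmult[OF DERIV_mult[OF this DERIV_Jacobi_P]] show ?thesis
      by (rule DERIV_cong) (use Suc.prems in \<open>simp add: powr_add algebra_simps\<close>)
  qed
  also have "(x + 1) * deriv ?P x + (b + 1) * ?P x = (real n + b + 1) * Jacobi_P (a + real (Suc j)) b n x"
    using Jacobi_P_raise[of "a + real j" x b n] assms(2) by (simp add: add_ac)
  also have "pochhammer (real n + b + 2) j * (x + 1) powr b * 
       ((real n + b + 1) * Jacobi_P (a + real (Suc j)) b n x) =
     pochhammer (real n + b + 1) (Suc j) * ((x + 1) powr b * Jacobi_P (a + real (Suc j)) b n x)"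
    using pochhammer_rec[of "real n + b + 1" j] by (simp add: add_ac mult_ac)
  finally have D: "(?f has_real_derivative 
     pochhammer (real n + b + 1) (Suc j) * ((x + 1) powr b * Jacobi_P (a + real (Suc j)) b n x)) (at x)" .
  have "((deriv ^^ j) (\<lambda>x. (x + 1) powr (b + real (Suc j)) * Jacobi_P a (b + real (Suc j)) n x) 
    has_real_derivative 
     pochhammer (real n + b + 1) (Suc j) * ((x + 1) powr b * Jacobi_P (a + real (Suc j)) b n x)) (at x)"
    by (rule has_field_derivative_transform_within_open[OF D, of "{-1<..}"]) (use Suc.prems eq in auto)
  then show ?case by (simp add: DERIV_imp_deriv)
qed simp

text \<open>
  The factor \<open>s - 1\<close> completes the inner weight to \<open>(s - 1)\<^sup>\<alpha>\<^sup>+\<^sup>2\<close>, which matches the first parameter of the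
  polynomial. So \<open>\<alpha> + 2\<close> lowering steps lead to the parameters \<open>(0, \<beta> + \<alpha> + 2)\<close>, and \<open>\<alpha> + 2\<close> raising
  steps lead back to \<open>(\<alpha> + 2, \<beta>)\<close>.
\<close>

lemma Jacobi_weighted_op_shifted:
  assumes x: "x \<in> {-1<..<1}"
  shows "Jacobi_weighted_op \<alpha> \<beta> (\<lambda>s. (s - 1) * Jacobi_P (real \<alpha> + 2) \<beta> n s) x =
    pochhammer (real n + 1) (\<alpha> + 2) * pochhammer (real n + \<beta> + 1) (\<alpha> + 2) *
      ((x + 1) powr \<beta> * Jacobi_P (real \<alpha> + 2) \<beta> n x)"
proof -
  let ?m = "\<alpha> + 2" and ?S = "{-1<..<1 :: real}"
  let ?c = "pochhammer (real n + 1) ?m"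
  let ?g = "\<lambda>t. (t + 1) powr (\<beta> + real ?m) * Jacobi_P 0 (\<beta> + real ?m) n t"
  have g: "times_differentiable_on k ?g ?S" for k
    by (intro times_differentiable_on_mult times_differentiable_on_powr_shift 
        times_differentiable_on_Jacobi_P) auto
  have inner: "(deriv ^^ ?m) (\<lambda>s. (s - 1) ^ (\<alpha> + 1) * ((s - 1) * Jacobi_P (real \<alpha> + 2) \<beta> n s)) =
      (\<lambda>t. ?c * Jacobi_P 0 (\<beta> + real ?m) n t)"
    using higher_deriv_power_mult_Jacobi_P[of ?m 0 \<beta> n] by (simp add: mult_ac add_ac del: funpow.simps)
  have "Jacobi_weighted_op \<alpha> \<beta> (\<lambda>s. (s - 1) * Jacobi_P (real \<alpha> + 2) \<beta> n s) x =
     (deriv ^^ ?m) (\<lambda>t. ?c * ?g t + 0 * ?g t) x"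
    unfolding Jacobi_weighted_op_def inner by (simp add: mult_ac add_ac del: funpow.simps)
  also have "\<dots> = ?c * (deriv ^^ ?m) ?g x"
    using higher_deriv_linear_combination2[OF _ x g g order_refl, of ?m ?c 0] by simp
  also have "(deriv ^^ ?m) ?g x = pochhammer (real n + \<beta> + 1) ?m * ((x + 1) powr \<beta> * Jacobi_P (real \<alpha> + 2) \<beta> n x)"
    using higher_deriv_powr_mult_Jacobi_P[of x 0 ?m \<beta> n] x by (simp add: add_ac)
  finally show ?thesis by (simp add: mult_ac)
qed

text \<open>
  The inner weight \<open>(s - 1)\<^sup>\<alpha>\<^sup>+\<^sup>1\<close> has one factor more than the \<open>\<alpha>\<close> lowering steps can use; splitting it off with
  \<open>higher_deriv_linear_factor\<close> leaves a combination of the polynomials with parameters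
  \<open>(0, \<beta> + \<alpha> + 2)\<close> and \<open>(1, \<beta> + \<alpha> + 1)\<close>. The outer weight fits the first of them. For the second it
  again has one factor \<open>t + 1\<close> too many, which is split off in the same way and is the source of the
  derivative of \<open>Q\<close>.
\<close>

lemma Jacobi_weighted_op_Jacobi_P:
  fixes \<alpha> n :: nat and \<beta> x :: real
  assumes x: "x \<in> {-1<..<1}"
  defines "Q \<equiv> Jacobi_P (real \<alpha> + 2) \<beta> n" and "\<kappa> \<equiv> real n + real \<alpha> + \<beta> + 2"
  shows "Jacobi_weighted_op \<alpha> \<beta> (Jacobi_P (real \<alpha>) \<beta> (Suc n)) x =
    pochhammer (real n + 2) \<alpha> * \<kappa> / 2 * pochhammer (real n + \<beta> + 1) (\<alpha> + 1) * (x + 1) powr \<beta> *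
      ((real n + 1) * \<kappa> * Q x + (real \<alpha> + 1) * ((x + 1) * deriv Q x + (real \<alpha> + \<beta> + 2) * Q x))"
proof -
  let ?m = "\<alpha> + 2" and ?S = "{-1<..<1 :: real}"
  let ?P = "Jacobi_P (real \<alpha>) \<beta> (Suc n)"
  define F where "F = (\<lambda>s :: real. (s - 1) ^ \<alpha> * ?P s)"
  define H where "H = Jacobi_P 1 (\<beta> + real \<alpha> + 1) n"
  define c where "c = pochhammer (real n + 2) \<alpha> * \<kappa> / 2"
  define e where "e = pochhammer (real n + \<beta> + 1) (\<alpha> + 1)"
  have F: "times_differentiable_on k F UNIV" for k
    unfolding F_def by (intro times_differentiable_on_mult times_differentiable_on_power_shift 
        times_differentiable_on_Jacobi_P) auto
  have F0: "(deriv ^^ \<alpha>) F = (\<lambda>t. pochhammer (real n + 2) \<alpha> * Jacobi_P 0 (\<beta> + real \<alpha>) (Suc n) t)"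
    using higher_deriv_power_mult_Jacobi_P[of \<alpha> 0 \<beta> "Suc n"] by (simp add: F_def add_ac)
  have F1: "(deriv ^^ (\<alpha> + 1)) F = (\<lambda>t. c * H t)"
  proof
    fix t
    have "((deriv ^^ \<alpha>) F has_real_derivative 
       pochhammer (real n + 2) \<alpha> * deriv (Jacobi_P 0 (\<beta> + real \<alpha>) (Suc n)) t) (at t)"
      unfolding F0 by (intro DERIV_cmult DERIV_Jacobi_P)
    then show "(deriv ^^ (\<alpha> + 1)) F t = c * H t"
      using deriv_Jacobi_P_Suc[of 0 "\<beta> + real \<alpha>" n t]
      by (simp add: DERIV_imp_deriv c_def H_def \<kappa>_def add_ac)
  qed
  have F2: "(deriv ^^ ?m) F = (\<lambda>t. c * deriv H t)"
  proof
    fix t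
    have "((deriv ^^ (\<alpha> + 1)) F has_real_derivative c * deriv H t) (at t)"
      unfolding F1 unfolding H_def by (intro DERIV_cmult DERIV_Jacobi_P)
    then show "(deriv ^^ ?m) F t = c * deriv H t"
      by (simp add: DERIV_imp_deriv)
  qed
  have inner: "(deriv ^^ ?m) (\<lambda>s. (s - 1) ^ (\<alpha> + 1) * ?P s) t =
      c * ((real n + 1) * Jacobi_P 0 (\<beta> + real ?m) n t + (real \<alpha> + 1) * H t)" for t
  proof -
    have "(\<lambda>s. (s - 1) ^ (\<alpha> + 1) * ?P s) = (\<lambda>s. (s - 1) * F s)"
      by (simp add: F_def mult_ac)
    then have "(deriv ^^ ?m) (\<lambda>s. (s - 1) ^ (\<alpha> + 1) * ?P s) t =
       (t - 1) * (deriv ^^ ?m) F t + real ?m * (deriv ^^ (?m - 1)) F t"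
      using higher_deriv_linear_factor[OF open_UNIV F UNIV_I, of ?m 1 t] by simp
    also have "?m - 1 = \<alpha> + 1" by simp
    also have "(t - 1) * (deriv ^^ ?m) F t + real ?m * (deriv ^^ (\<alpha> + 1)) F t =
       c * (((t - 1) * deriv H t + 1 * H t) + (real \<alpha> + 1) * H t)"
      unfolding F1 F2 by (simp add: algebra_simps)
    also have "(t - 1) * deriv H t + 1 * H t = (real n + 1) * Jacobi_P 0 (\<beta> + real ?m) n t"
      using Jacobi_P_lower[of 0 t "\<beta> + real \<alpha> + 1" n] by (simp add: H_def add_ac)
    finally show ?thesis .
  qed
  define g1 where "g1 = (\<lambda>t. (t + 1) powr (\<beta> + real ?m) * Jacobi_P 0 (\<beta> + real ?m) n t)"
  define G where "G = (\<lambda>t. (t + 1) powr (\<beta> + real (\<alpha> + 1)) * Jacobi_P 1 (\<beta> + real (\<alpha> + 1)) n t)"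
  define g2 where "g2 = (\<lambda>t. (t - (- 1)) * G t)"
  have S: "open ?S" by simp
  have G: "times_differentiable_on k G ?S" for k
    unfolding G_def by (intro times_differentiable_on_mult times_differentiable_on_powr_shift 
        times_differentiable_on_Jacobi_P) auto
  have g1: "times_differentiable_on k g1 ?S" for k
    unfolding g1_def by (intro times_differentiable_on_mult times_differentiable_on_powr_shift 
        times_differentiable_on_Jacobi_P) auto
  have g2: "times_differentiable_on k g2 ?S" for k
    using times_differentiable_on_power_shift[OF S, of k "-1" 1] G
    unfolding g2_def by (intro times_differentiable_on_mult S) auto
  have lin: "times_differentiable_on k (\<lambda>t. c * (real n + 1) * g1 t + c * (real \<alpha> + 1) * g2 t) ?S" for k
    using times_differentiable_on_linear_combination[OF S, of "UNIV :: bool set" k "\<lambda>i. if i then g1 else g2"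
      "\<lambda>i. if i then c * (real n + 1) else c * (real \<alpha> + 1)"] g1 g2
    by (simp add: UNIV_bool add.commute)
  have weight: "(t + 1) powr (real \<alpha> + \<beta> + 2) * H t = g2 t" if "t > -1" for t
  proof -
    have "real \<alpha> + \<beta> + 2 = (\<beta> + real (\<alpha> + 1)) + 1" by simp
    then have "(t + 1) powr (real \<alpha> + \<beta> + 2) = (t + 1) powr (\<beta> + real (\<alpha> + 1)) * (t + 1)"
      using that by (simp only: powr_add) simp
    then show ?thesis by (simp add: g2_def G_def H_def add_ac mult_ac)
  qed
  have "Jacobi_weighted_op \<alpha> \<beta> ?P x = (deriv ^^ ?m) (\<lambda>t. c * (real n + 1) * g1 t + c * (real \<alpha> + 1) * g2 t) x"
    unfolding Jacobi_weighted_op_def inner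
  proof (rule higher_deriv_cong_open[OF S lin _ order_refl x])
    fix t assume "t \<in> ?S"
    then have "t > -1" by simp
    then show "c * (real n + 1) * g1 t + c * (real \<alpha> + 1) * g2 t =
      (t + 1) powr (real \<alpha> + \<beta> + 2) * (c * ((real n + 1) * Jacobi_P 0 (\<beta> + real ?m) n t + (real \<alpha> + 1) * H t))"
      unfolding weight[symmetric, OF \<open>t > -1\<close>] by (simp add: g1_def algebra_simps)
  qed
  also have "\<dots> = c * (real n + 1) * (deriv ^^ ?m) g1 x + c * (real \<alpha> + 1) * (deriv ^^ ?m) g2 x"
    by (rule higher_deriv_linear_combination2[OF S x g1 g2 order_refl])
  also have "(deriv ^^ ?m) g1 x = pochhammer (real n + \<beta> + 1) ?m * ((x + 1) powr \<beta> * Q x)"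
    using higher_deriv_powr_mult_Jacobi_P[of x 0 ?m \<beta> n] x by (simp add: g1_def Q_def add_ac)
  also have "pochhammer (real n + \<beta> + 1) ?m = e * \<kappa>"
    by (simp add: e_def \<kappa>_def pochhammer_Suc)
  also have "(deriv ^^ ?m) g2 x = e * (x + 1) powr \<beta> * ((x + 1) * deriv Q x + (real \<alpha> + \<beta> + 2) * Q x)"
  proof -
    have G1: "e * ((t + 1) powr \<beta> * Q t) = (deriv ^^ (\<alpha> + 1)) G t" if "t > -1" for t
      using higher_deriv_powr_mult_Jacobi_P[of t 1 "\<alpha> + 1" \<beta> n] that by (simp add: G_def Q_def e_def add_ac)
    have D: "((\<lambda>t. e * ((t + 1) powr \<beta> * Q t)) has_real_derivative 
        e * (\<beta> * (x + 1) powr (\<beta> - 1) * Q x + (x + 1) powr \<beta> * deriv Q x)) (at x)"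
      using x DERIV_Jacobi_P[of "real \<alpha> + 2" \<beta> n x, folded Q_def] 
      by (auto intro!: derivative_eq_intros)
    have "((deriv ^^ (\<alpha> + 1)) G has_real_derivative 
        e * (\<beta> * (x + 1) powr (\<beta> - 1) * Q x + (x + 1) powr \<beta> * deriv Q x)) (at x)"
      by (rule has_field_derivative_transform_within_open[OF D, of "{-1<..}"]) (use x G1 in auto)
    then have G2: "(deriv ^^ ?m) G x = 
        e * (\<beta> * (x + 1) powr (\<beta> - 1) * Q x + (x + 1) powr \<beta> * deriv Q x)"
      by (simp add: DERIV_imp_deriv)
    have w: "(x + 1) powr \<beta> = (x + 1) * (x + 1) powr (\<beta> - 1)"
      using x by (simp add: powr_diff)
    have "(deriv ^^ ?m) g2 x = (x + 1) * (deriv ^^ ?m) G x + real ?m * (deriv ^^ (?m - 1)) G x"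
      unfolding g2_def using higher_deriv_linear_factor[OF S G x, of ?m "-1"] by simp
    also have "?m - 1 = \<alpha> + 1" by simp
    also have "(deriv ^^ (\<alpha> + 1)) G x = e * ((x + 1) powr \<beta> * Q x)"
      using G1 x by simp
    finally show ?thesis
      unfolding G2 w by (simp add: algebra_simps del: funpow.simps add_2_eq_Suc')
  qed
  finally show ?thesis
    unfolding c_def[symmetric] e_def[symmetric] by (simp add: algebra_simps)
qed

text \<open>
  The amplitude of \<open>R\<close> is exactly the one that makes the two multiples of \<open>Q\<close> cancel which obstruct
  the eigenvalue equation: one from the part of order \<open>2 * \<alpha> + 4\<close> applied to \<open>P\<close>, the other from the
  second-order part applied to \<open>R\<close>.
\<close>

lemma Jacobi_A_normalization:
  assumes \<beta>: "\<beta> > -1"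
  shows "2 * Jacobi_A (real \<alpha>) \<beta> (Suc n) * C_const \<alpha> \<beta> =
    pochhammer (real n + 2) \<alpha> * (real n + real \<alpha> + \<beta> + 2) * pochhammer (real n + \<beta> + 1) (\<alpha> + 1) * (real \<alpha> + 2)"
proof -
  have pos: "pochhammer (\<beta> + 1) n > 0" using \<beta> by (intro pochhammer_pos) simp
  have 1: "pochhammer (real \<alpha> + 2) n * fact (\<alpha> + 2) = (real \<alpha> + 2) * (pochhammer (real n + 2) \<alpha> * fact (Suc n))"
  proof -
    have "fact (\<alpha> + 1 + n) = fact (\<alpha> + 1) * pochhammer (real \<alpha> + 2) n"
      using fact_add_eq_pochhammer[of "\<alpha> + 1" n] by (simp add: add_ac)
    moreover have "fact (Suc n + \<alpha>) = fact (Suc n) * pochhammer (real n + 2) \<alpha>"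
      using fact_add_eq_pochhammer[of "Suc n" \<alpha>] by (simp add: add_ac)
    moreover have "\<alpha> + 1 + n = Suc n + \<alpha>" by simp
    ultimately have e: "fact (\<alpha> + 1) * pochhammer (real \<alpha> + 2) n = fact (Suc n) * pochhammer (real n + 2) \<alpha>"
      by metis
    have "pochhammer (real \<alpha> + 2) n * fact (\<alpha> + 2) = (real \<alpha> + 2) * (fact (\<alpha> + 1) * pochhammer (real \<alpha> + 2) n)"
      by (simp add: algebra_simps)
    then show ?thesis unfolding e by (simp only: mult_ac)
  qed
  have 2: "pochhammer (real \<alpha> + \<beta> + 2) (Suc n) * pochhammer (\<beta> + 1) (\<alpha> + 1) =
     pochhammer (\<beta> + 1) n * (pochhammer (real n + \<beta> + 1) (\<alpha> + 1) * (real n + real \<alpha> + \<beta> + 2))"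
  proof -
    have "pochhammer (\<beta> + 1) (\<alpha> + 1 + Suc n) = pochhammer (\<beta> + 1) (\<alpha> + 1) * pochhammer (real \<alpha> + \<beta> + 2) (Suc n)"
      unfolding pochhammer_product' by (simp add: add_ac)
    moreover have "pochhammer (\<beta> + 1) (n + (\<alpha> + 1 + 1)) = 
        pochhammer (\<beta> + 1) n * (pochhammer (real n + \<beta> + 1) (\<alpha> + 1) * (real n + real \<alpha> + \<beta> + 2))"
      unfolding pochhammer_product' by (simp add: add_ac)
    moreover have "\<alpha> + 1 + Suc n = n + (\<alpha> + 1 + 1)" by simp
    ultimately show ?thesis by (metis mult.commute)
  qed
  have "2 * Jacobi_A (real \<alpha>) \<beta> (Suc n) * C_const \<alpha> \<beta> =
     (pochhammer (real \<alpha> + 2) n * fact (\<alpha> + 2)) * (pochhammer (real \<alpha> + \<beta> + 2) (Suc n) * pochhammer (\<beta> + 1) (\<alpha> + 1)) /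
       (fact (Suc n) * pochhammer (\<beta> + 1) n)"
    by (simp add: Jacobi_A_def C_const_def del: fact_Suc pochhammer_Suc)
  also have "\<dots> = (real \<alpha> + 2) * pochhammer (real n + 2) \<alpha> * 
      (pochhammer (real n + \<beta> + 1) (\<alpha> + 1) * (real n + real \<alpha> + \<beta> + 2))"
    unfolding 1 2 using pos by (simp add: field_simps del: fact_Suc)
  finally show ?thesis by (simp only: mult_ac)
qed

section \<open>The eigenvalue equation\<close>

lemma Jacobi_weighted_op_linear_combination2:
  assumes x: "x \<in> {-1<..<1}"
    and f: "times_differentiable_on (2 * (\<alpha> + 2)) f {-1<..<1}" 
    and g: "times_differentiable_on (2 * (\<alpha> + 2)) g {-1<..<1}"
  shows "Jacobi_weighted_op \<alpha> \<beta> (\<lambda>s. a * f s + b * g s) x =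
    a * Jacobi_weighted_op \<alpha> \<beta> f x + b * Jacobi_weighted_op \<alpha> \<beta> g x"
proof -
  let ?S = "{-1<..<1 :: real}" and ?h = "\<lambda>i. if i then f else g" and ?k = "\<lambda>i. if i then a else b"
  have S: "open ?S" by simp
  have w: "times_differentiable_on k (\<lambda>t. (t + 1) powr (real \<alpha> + \<beta> + 2)) ?S" for k
    by (rule times_differentiable_on_powr_shift) auto
  have v: "times_differentiable_on k (\<lambda>s. (s - 1) ^ (\<alpha> + 1)) ?S" for k
    by (rule times_differentiable_on_power_shift) auto
  have "times_differentiable_on (2 * (\<alpha> + 2)) (?h i) ?S" if "i \<in> UNIV" for i
    using f g by simp
  from weighted_higher_deriv_linear_combination[where I = UNIV and c = ?k and f = ?h, OF S x v w this]
  show ?thesis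
    by (simp add: Jacobi_weighted_op_def UNIV_bool add.commute del: funpow.simps add_2_eq_Suc')
qed

lemma Jacobi_type_eq_poly:
  "Jacobi_type a b N n = (\<lambda>x. poly (Jacobi_poly a b n + 
     (if n = 0 then 0 else smult (2 * N * Jacobi_A a b n) (pCons 0 (Jacobi_poly (a + 2) b (n - 1))))) ((x - 1) / 2))"
  by (auto simp: fun_eq_iff Jacobi_type_def Jacobi_R_def Jacobi_P_eq_poly algebra_simps)

text \<open>
  At \<open>x = 1\<close> the term \<open>R\<close> vanishes while the classical Jacobi polynomial does not. So the polynomial is not
  identically zero, hence not zero on an interval.
\<close>

lemma Jacobi_type_nonzero:
  assumes "a > -1"
  shows "\<exists>x\<in>{-1<..<1}. Jacobi_type a b N n x \<noteq> 0"
proof (rule ccontr)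
  assume "\<not> ?thesis"
  then have zero: "Jacobi_type a b N n x = 0" if "x \<in> {-1<..<1}" for x using that by blast
  define p where "p = Jacobi_poly a b n + 
     (if n = 0 then 0 else smult (2 * N * Jacobi_A a b n) (pCons 0 (Jacobi_poly (a + 2) b (n - 1))))"
  have "poly p u = 0" if "u \<in> {-1<..<0}" for u
    using zero[of "2 * u + 1"] that unfolding Jacobi_type_eq_poly p_def[symmetric] by simp
  then have "{-1<..<0} \<subseteq> {u. poly p u = 0}" by blast
  moreover have "infinite {-1<..<0 :: real}" by (rule infinite_Ioo) simp
  ultimately have "infinite {u. poly p u = 0}"
    by (rule infinite_super)
  then have "p = 0" using poly_roots_finite by blast
  then have "coeff p 0 = 0" by simp
  moreover have "coeff p 0 = pochhammer (a + 1) n / fact n"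
    by (simp add: p_def Jacobi_coeff_def)
  moreover have "pochhammer (a + 1) n > 0" using assms by (intro pochhammer_pos) simp
  ultimately show False by simp
qed

text \<open>
  Up to the common weight \<open>X * W\<close>, the higher-order part has the eigenvalue \<open>a\<close> and the
  second-order part the eigenvalue \<open>b\<close>, each up to a multiple of \<open>Q\<close> (\<open>opP\<close>, \<open>opQ\<close>, \<open>J\<close>); the multiples
  cancel by \<open>norm\<close>, and \<open>\<Lambda>\<close> splits as \<open>N a + C b\<close>.
\<close>

lemma Jacobi_type_eigen:
  fixes \<alpha> n :: nat and \<beta> N x :: real
  assumes \<beta>: "\<beta> > -1" and x: "x \<in> {-1<..<1}"
  defines "y \<equiv> Jacobi_type (real \<alpha>) \<beta> N n"
  shows "N * (x - 1) ^ (\<alpha> + 1) * Jacobi_weighted_op \<alpha> \<beta> y x + 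
     C_const \<alpha> \<beta> * deriv (\<lambda>t. (t - 1) ^ (\<alpha> + 1) * (t + 1) powr (\<beta> + 1) * deriv y t) x =
     Lambda_eig \<alpha> \<beta> N n * (x - 1) ^ \<alpha> * (x + 1) powr \<beta> * y x"
proof (cases n)
  \<comment> \<open>The constant function 1 is annihilated by both parts, and the eigenvalue is 0.\<close>
  case 0
  have y: "y = (\<lambda>t. 1)"
    by (simp add: y_def 0 fun_eq_iff Jacobi_type_eq_poly Jacobi_poly_def Jacobi_coeff_def)
  have "(x - 1) / (x + 1) powr \<beta> * Jacobi_weighted_op \<alpha> \<beta> (\<lambda>t. (t - 1) ^ 0) x = 0"
    unfolding Jacobi_weighted_op_monomial[OF x] by (simp add: monomial_coeff_eq_0)
  then have "Jacobi_weighted_op \<alpha> \<beta> y x = 0" using x by (simp add: y)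
  then show ?thesis by (simp add: y Lambda_eig_def 0)
next
  case n: (Suc k)
  let ?S = "{-1<..<1 :: real}"
  define P where "P = Jacobi_P (real \<alpha>) \<beta> n"
  define Q where "Q = Jacobi_P (real \<alpha> + 2) \<beta> k"
  define A where "A = Jacobi_A (real \<alpha>) \<beta> n"
  define C where "C = C_const \<alpha> \<beta>"
  define \<kappa> where "\<kappa> = real k + real \<alpha> + \<beta> + 2"
  define r where "r = pochhammer (real k + 2) \<alpha>"
  define e where "e = pochhammer (real k + \<beta> + 1) (\<alpha> + 1)"
  define a where "a = r * (real k + real \<alpha> + 2) * e * (real k + 1) * \<kappa>"
  define X where "X = (x - 1) ^ \<alpha>"
  define W where "W = (x + 1) powr \<beta>"
  have y_eq: "y = (\<lambda>s. 1 * P s + (N * A) * ((s - 1) * Q s))"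
    by (simp add: y_def fun_eq_iff Jacobi_type_def Jacobi_R_def P_def Q_def A_def n)
  have opP: "(x - 1) * Jacobi_weighted_op \<alpha> \<beta> P x = W * (a * P x - r * \<kappa> * e * (real \<alpha> + 2) * (real \<alpha> + 1) * Q x)"
  proof -
    have "(real k + 1) * (real k + real \<alpha> + 2) * P x - (real \<alpha> + 2) * (real \<alpha> + 1) * Q x =
        (x - 1) / 2 * ((real k + 1) * \<kappa> * Q x + 
          (real \<alpha> + 1) * ((x + 1) * deriv Q x + (real \<alpha> + \<beta> + 2) * Q x))" (is "?l = _ / 2 * ?B")
      using Jacobi_P_contiguous[of "real \<alpha>" k \<beta> x] by (simp add: P_def Q_def n \<kappa>_def)
    then have B: "(x - 1) * ?B = 2 * ?l" by simp
    have "Jacobi_weighted_op \<alpha> \<beta> P x = r * \<kappa> / 2 * e * W * ?B"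
      unfolding P_def n Jacobi_weighted_op_Jacobi_P[OF x] r_def \<kappa>_def e_def W_def Q_def ..
    then have "(x - 1) * Jacobi_weighted_op \<alpha> \<beta> P x = r * \<kappa> / 2 * e * W * ((x - 1) * ?B)"
      by simp
    then show ?thesis
      unfolding B by (simp add: a_def algebra_simps)
  qed
  have opQ: "Jacobi_weighted_op \<alpha> \<beta> (\<lambda>s. (s - 1) * Q s) x = a * (W * Q x)"
  proof -
    have "pochhammer (real k + 1) (\<alpha> + 2) = (real k + 1) * (r * (real k + real \<alpha> + 2))"
      using pochhammer_rec[of "real k + 1" "Suc \<alpha>"] pochhammer_Suc[of "real k + 2" \<alpha>] 
      by (simp add: r_def add_ac)
    moreover have "pochhammer (real k + \<beta> + 1) (\<alpha> + 2) = e * \<kappa>"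
      using pochhammer_Suc[of "real k + \<beta> + 1" "\<alpha> + 1"] by (simp add: e_def \<kappa>_def add_ac)
    ultimately show ?thesis
      unfolding Q_def Jacobi_weighted_op_shifted[OF x] W_def by (simp add: a_def)
  qed
  have tdo: "times_differentiable_on j P ?S" "times_differentiable_on j (\<lambda>s. (s - 1) * Q s) ?S" for j
  proof -
    show "times_differentiable_on j P ?S"
      unfolding P_def by (simp add: times_differentiable_on_Jacobi_P)
    show "times_differentiable_on j (\<lambda>s. (s - 1) * Q s) ?S"
      using times_differentiable_on_power_shift[of ?S j 1 1] unfolding Q_def
      by (intro times_differentiable_on_mult times_differentiable_on_Jacobi_P) auto
  qed
  have opy: "Jacobi_weighted_op \<alpha> \<beta> y x = Jacobi_weighted_op \<alpha> \<beta> P x + N * A * (a * (W * Q x))"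
    unfolding y_eq Jacobi_weighted_op_linear_combination2[OF x tdo] opQ by simp
  define b where "b = (real k + 1) * \<kappa>"
  have J: "deriv (\<lambda>t. (t - 1) ^ (\<alpha> + 1) * (t + 1) powr (\<beta> + 1) * deriv y t) x =
      X * W * (b * P x + N * A * (b * ((x - 1) * Q x) + 2 * (real \<alpha> + 1) * Q x))"
  proof -
    let ?p = "Jacobi_poly (real \<alpha>) \<beta> n" and ?q = "Jacobi_poly (real \<alpha> + 2) \<beta> k"
    let ?y = "?p + smult (2 * N * A) (pCons 0 ?q)"
    have y: "y = (\<lambda>x. poly ?y ((x - 1) / 2))"
      by (simp add: y_def Jacobi_type_eq_poly n A_def)
    have Jp: "Jacobi_operator (real \<alpha>) \<beta> ?p = smult b ?p"
      using Jacobi_operator_eigen[of "real \<alpha>" \<beta> n] by (simp add: b_def \<kappa>_def n add_ac)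
    have Jq: "Jacobi_operator (real \<alpha>) \<beta> (pCons 0 ?q) = smult b (pCons 0 ?q) + smult (real \<alpha> + 1) ?q"
      using Jacobi_operator_shifted[of "real \<alpha>" \<beta> k] by (simp add: b_def \<kappa>_def)
    have "Jacobi_operator (real \<alpha>) \<beta> ?y =
       Jacobi_operator (real \<alpha>) \<beta> ?p + smult (2 * N * A) (Jacobi_operator (real \<alpha>) \<beta> (pCons 0 ?q))"
      by (simp only: Jacobi_operator_def pderiv_add pderiv_smult mult_smult_right distrib_left smult_add_right add_ac)
    then have poly_y: "poly (Jacobi_operator (real \<alpha>) \<beta> ?y) ((x - 1) / 2) = 
        b * P x + N * A * (b * ((x - 1) * Q x) + 2 * (real \<alpha> + 1) * Q x)"
      unfolding Jp Jq by (simp add: P_def Q_def Jacobi_P_eq_poly field_simps)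
    show ?thesis
      unfolding y poly_y[symmetric] X_def W_def by (rule deriv_Jacobi_operator) (use x in simp)
  qed
  have norm: "2 * A * C = r * \<kappa> * e * (real \<alpha> + 2)"
    using Jacobi_A_normalization[OF \<beta>, of \<alpha> k] by (simp add: A_def C_def n r_def \<kappa>_def e_def)
  have \<Lambda>: "Lambda_eig \<alpha> \<beta> N n = N * a + C * b"
  proof -
    have "pochhammer (real n + 1) (\<alpha> + 1) = r * (real k + real \<alpha> + 2)"
      by (simp add: n r_def pochhammer_Suc add_ac)
    moreover have "pochhammer (real n + \<beta>) (\<alpha> + 1) = e"
      by (simp add: n e_def add_ac)
    moreover have "pochhammer 2 (\<alpha> + 1) = (fact (\<alpha> + 2) :: real)"
      using fact_add_eq_pochhammer[of 1 "\<alpha> + 1"] by (simp add: add_ac)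
    moreover have "real n * (real n + real \<alpha> + \<beta> + 1) = b"
      by (simp add: n b_def \<kappa>_def add_ac)
    ultimately show ?thesis
      unfolding Lambda_eig_def C_def C_const_def by (simp add: a_def b_def algebra_simps del: fact_Suc)
  qed
  have "N * (x - 1) ^ (\<alpha> + 1) * Jacobi_weighted_op \<alpha> \<beta> y x + 
     C * deriv (\<lambda>t. (t - 1) ^ (\<alpha> + 1) * (t + 1) powr (\<beta> + 1) * deriv y t) x = 
     N * X * ((x - 1) * Jacobi_weighted_op \<alpha> \<beta> P x + N * A * (a * (W * ((x - 1) * Q x)))) + 
     C * (X * W * (b * P x + N * A * (b * ((x - 1) * Q x) + 2 * (real \<alpha> + 1) * Q x)))"
    unfolding J opy by (simp add: X_def algebra_simps)
  also have "\<dots> = X * W * ((N * a + C * b) * (P x + N * A * ((x - 1) * Q x)) + 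
      N * (real \<alpha> + 1) * Q x * (2 * A * C - r * \<kappa> * e * (real \<alpha> + 2)))"
    unfolding opP by (simp add: algebra_simps)
  also have "\<dots> = Lambda_eig \<alpha> \<beta> N n * X * W * y x"
    unfolding norm \<Lambda> by (simp add: y_eq)
  finally show ?thesis
    unfolding C_def X_def W_def .
qed

theorem theorem1p1:
  fixes \<alpha> :: nat and \<beta> :: real
  assumes "\<beta> > -1"
  shows "(\<forall>y :: real \<Rightarrow> real. times_differentiable_on (2 * \<alpha> + 4) y {-1<..<1} \<longrightarrow>
            (\<forall>x\<in>{-1<..<1}.
               L_expr \<alpha> \<beta> y x =
               (x - 1) / (x + 1) powr \<beta> *
               (deriv ^^ (\<alpha> + 2))
                 (\<lambda>t. (t + 1) powr (real \<alpha> + \<beta> + 2) *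
                      (deriv ^^ (\<alpha> + 2)) (\<lambda>s. (s - 1) ^ (\<alpha> + 1) * y s) t) x))
       \<and> (\<forall>N::real. N > 0 \<longrightarrow> (\<forall>n::nat.
            (let y = Jacobi_type (real \<alpha>) \<beta> N n in
               times_differentiable_on (2 * \<alpha> + 4) y {-1<..<1} \<and>
               (\<exists>x\<in>{-1<..<1}. y x \<noteq> 0) \<and>
               (\<forall>x\<in>{-1<..<1}.
                  N * (x - 1) ^ (\<alpha> + 1) *
                  (deriv ^^ (\<alpha> + 2))
                    (\<lambda>t. (t + 1) powr (real \<alpha> + \<beta> + 2) *
                         (deriv ^^ (\<alpha> + 2)) (\<lambda>s. (s - 1) ^ (\<alpha> + 1) * y s) t) x
                  + C_const \<alpha> \<beta> *
                    deriv (\<lambda>t. (t - 1) ^ (\<alpha> + 1) * (t + 1) powr (\<beta> + 1) * deriv y t) x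
                  = Lambda_eig \<alpha> \<beta> N n * (x - 1) ^ \<alpha> * (x + 1) powr \<beta> * y x))))"
  unfolding Let_def
proof (intro conjI allI impI ballI)
  fix y :: "real \<Rightarrow> real" and x :: real
  assume "times_differentiable_on (2 * \<alpha> + 4) y {-1<..<1}" "x \<in> {-1<..<1}"
  from L_expr_eq[OF assms this] show "L_expr \<alpha> \<beta> y x =
      (x - 1) / (x + 1) powr \<beta> * (deriv ^^ (\<alpha> + 2))
        (\<lambda>t. (t + 1) powr (real \<alpha> + \<beta> + 2) * (deriv ^^ (\<alpha> + 2)) (\<lambda>s. (s - 1) ^ (\<alpha> + 1) * y s) t) x"
    unfolding Jacobi_weighted_op_def .
next
  fix N :: real and n :: nat
  show "times_differentiable_on (2 * \<alpha> + 4) (Jacobi_type (real \<alpha>) \<beta> N n) {-1<..<1}"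
    unfolding Jacobi_type_eq_poly by (rule times_differentiable_on_poly_scaled) simp
  show "\<exists>x\<in>{-1<..<1}. Jacobi_type (real \<alpha>) \<beta> N n x \<noteq> 0"
    by (rule Jacobi_type_nonzero) simp
  fix x :: real assume "x \<in> {-1<..<1}"
  from Jacobi_type_eigen[OF assms this, of N \<alpha> n]
  show "N * (x - 1) ^ (\<alpha> + 1) * (deriv ^^ (\<alpha> + 2))
        (\<lambda>t. (t + 1) powr (real \<alpha> + \<beta> + 2) *
           (deriv ^^ (\<alpha> + 2)) (\<lambda>s. (s - 1) ^ (\<alpha> + 1) * Jacobi_type (real \<alpha>) \<beta> N n s) t) x
      + C_const \<alpha> \<beta> * deriv (\<lambda>t. (t - 1) ^ (\<alpha> + 1) * (t + 1) powr (\<beta> + 1) *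
           deriv (Jacobi_type (real \<alpha>) \<beta> N n) t) x
      = Lambda_eig \<alpha> \<beta> N n * (x - 1) ^ \<alpha> * (x + 1) powr \<beta> * Jacobi_type (real \<alpha>) \<beta> N n x"
    unfolding Jacobi_weighted_op_def .
qed

end
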